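(* Let $k\ge 4$ be an integer. (1) For every finite abelian group $G$ of order $k$ and all probability laws $\mu,\nu$ on $G$ with $\mu,\nu\in\mathcal B_k$, the additive convolution $\mu\oplus\nu$ belongs to $\mathcal B_k$. (2) For every finite field $\mathbb F$ of order $k$ and all probability laws $\mu,\nu$ on $\mathbb F$ with $\mu,\nu\in\mathcal B_k$, the multiplicative convolution $\mu\otimes\nu$ belongs to $\mathcal B_k$.
   Context: For an integer $k\ge 2$ and $t\in[0,1]$ put $\psi_k(t):=\dfrac{1-t-(1-t)^k}{k-1}$. For a probability law $p$ on a set of $k$ points, let $p_1^{\downarrow}\ge p_2^{\downarrow}\ge\cdots\ge p_k^{\downarrow}$ be its atoms sorted in decreasing order (with multiplicity). The body $\mathcal B_k$ is the set of probability laws $p$ on $k$ points with $p_k^{\downarrow}\ge\psi_k(p_2^{\downarrow})$; equivalently $1-p_2^{\downarrow}-(k-1)p_k^{\downarrow}\le(1-p_2^{\downarrow})^k$. For laws $\mu,\nu$ on a finite abelian group $G$ (written additively), $(\mu\oplus\nu)(g)=\sum_{h+h'=g}\mu(h)\nu(h')$. For laws $\mu,\nu$ on a finite field $\mathbb F$, $(\mu\otimes\nu)(g)=\sum_{hh'=g}\mu(h)\nu(h')$, the sum being over all $h,h'\in\mathbb F$ (including zero). *)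

theory Defs
  imports
    "HOL-Probability.Probability_Mass_Function"
    "HOL-Library.Multiset"
    "HOL-Algebra.Coset"
    "HOL-Algebra.Ring"
begin

definition psi :: "nat \<Rightarrow> real \<Rightarrow> real" where
  "psi k t = (1 - t - (1 - t) ^ k) / (real k - 1)"

text \<open>
  \<open>desc_atom A p j\<close> is the \<open>j\<close>-th largest atom of \<open>p\<close> on the finite set \<open>A\<close>, for
  \<open>1 \<le> j \<le> card A\<close>. Every point of \<open>A\<close> contributes one entry, so that equal and zero
  atoms are counted with multiplicity; the list is indexed from \<open>0\<close>.
\<close>

definition desc_atom :: "'a set \<Rightarrow> 'a pmf \<Rightarrow> nat \<Rightarrow> real" where
  "desc_atom A p j =
     rev (sorted_list_of_multiset (image_mset (pmf p) (mset_set A))) ! (j - 1)"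

text \<open>
  The laws on the \<open>k\<close>-point set \<open>A\<close> are the mass functions on the ambient type that are
  supported in \<open>A\<close>.
\<close>

definition body :: "nat \<Rightarrow> 'a set \<Rightarrow> 'a pmf set" where
  "body k A =
     {p. card A = k \<and> set_pmf p \<subseteq> A \<and> desc_atom A p k \<ge> psi k (desc_atom A p 2)}"

text \<open>
  The convolution of two laws with respect to the operation \<open>\<otimes>\<^bsub>G\<^esub>\<close>. A group in HOL-Algebra
  is a multiplicatively written record, so for an abelian group this is additive
  convolution; a ring record extends the monoid record by its multiplication, so for a field
  this is multiplicative convolution on the whole field, zero included. The lemma
  \<open>pmf_convolution\<close> gives the usual formula for its atoms.
\<close>

definition convolution :: "('a, 'b) monoid_scheme \<Rightarrow> 'a pmf \<Rightarrow> 'a pmf \<Rightarrow> 'a pmf" where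
  "convolution G \<mu> \<nu> = map_pmf (\<lambda>(h, h'). h \<otimes>\<^bsub>G\<^esub> h') (pair_pmf \<mu> \<nu>)"

lemma pmf_convolution:
  assumes "finite (carrier G)" "set_pmf \<mu> \<subseteq> carrier G" "set_pmf \<nu> \<subseteq> carrier G"
  shows "pmf (convolution G \<mu> \<nu>) g =
    (\<Sum>(h, h') \<in> {(h, h') \<in> carrier G \<times> carrier G. h \<otimes>\<^bsub>G\<^esub> h' = g}. pmf \<mu> h * pmf \<nu> h')"
proof -
  let ?f = "\<lambda>(h, h'). h \<otimes>\<^bsub>G\<^esub> h'"
  let ?S = "{(h, h') \<in> carrier G \<times> carrier G. h \<otimes>\<^bsub>G\<^esub> h' = g}"
  let ?P = "pair_pmf \<mu> \<nu>"
  have fin: "finite ?S"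
    by (rule finite_subset[of _ "carrier G \<times> carrier G"]) (use assms in auto)
  have eq: "(?f -` {g}) \<inter> set_pmf ?P = ?S \<inter> set_pmf ?P"
    using assms by auto
  have "pmf (convolution G \<mu> \<nu>) g = measure ?P (?f -` {g})"
    by (simp add: convolution_def pmf_map)
  also have "\<dots> = measure ?P ?S"
    using measure_Int_set_pmf[of ?P "?f -` {g}"] measure_Int_set_pmf[of ?P ?S]
    by (simp only: eq)
  also have "\<dots> = (\<Sum>x\<in>?S. pmf ?P x)"
    by (rule measure_measure_pmf_finite[OF fin])
  also have "\<dots> = (\<Sum>(h, h')\<in>?S. pmf \<mu> h * pmf \<nu> h')"
    by (rule sum.cong) (auto simp: pmf_pair)
  finally show ?thesis .
qed

end

theory Submission
  imports Defs
begin

text \<open>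
  Write \<open>k = n + 1\<close>. A law with second atom \<open>s\<close> and smallest atom \<open>m\<close> is in the body iff \<open>psi k s \<le> m\<close>. With
  \<open>u = 1 - s\<close> this says \<open>u - n * m \<le> u ^ k\<close>, and this inequality can be multiplied: for two laws one obtains
  \<open>psi k (1 - u * u') \<le> m * u' + m' * u - n * m * m'\<close>. On the other hand, away from the product of two
  points carrying the largest atoms, a convolution has no atom above \<open>1 - u * u' = s + s' - s * s'\<close>. These
  two facts meet in \<open>psi_le_product_bound\<close>. It settles finite groups
  (\<open>group.convolution_in_body\<close>), because there every atom of the convolution is at least
  \<open>m + m' - k * m * m'\<close>.

  In a field, zero absorbs mass: the convolution has the atom \<open>z + z' - z * z'\<close> at zero, where \<open>z\<close> and \<open>z'\<close>
  are the atoms of the factors at zero, and the atoms at the units are at least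
  \<open>m * (1 - z') + m' * (1 - z) - n * m * m'\<close>. If neither law has its largest atom at zero, the same
  argument works unless zero becomes the largest atom of the convolution. Then it bounds \<open>psi\<close> at
  that largest atom, and \<open>psi_second_of_psi_first\<close> transfers the bound to the second atom.

  If the first law has its largest atom at zero, then the atoms of the convolution at the units lie
  between \<open>m * Y + m' * c\<close> and \<open>s * Y + m' * c\<close>, where \<open>c = 1 - z\<close> and \<open>Y = 1 - z' - n * m'\<close>, so it suffices to
  compare these two numbers. If the second law has its largest atom elsewhere, it is compared with a
  member of a one-parameter convolution semigroup, and the comparison is verified along the
  corresponding linear flow (\<open>defect_flow\<close>). If both laws have their largest atom at zero, there are
  two such comparisons, one for each law, and they cannot both fail: the product of the two failures
  contradicts an inequality that holds for each law separately
  (\<open>min_atom_beats_geometric_loss\<close>).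
\<close>

section \<open>Powers and the profile function\<close>

text \<open>
  The graph of \<open>x ^ Suc n\<close> lies above its tangent at \<open>y\<close>. The monotonicity of
  \<open>psi\<close> and of its defect, and the estimates of their slopes, all come from this convexity.
\<close>

lemma power_ge_tangent:
  fixes x y :: real
  assumes "0 \<le> x" "0 \<le> y"
  shows "y ^ Suc n + real (Suc n) * y ^ n * (x - y) \<le> x ^ Suc n"
proof (induction n)
  case 0
  then show ?case by simp
next
  case (Suc n)
  have "0 \<le> real (Suc n) * y ^ n * (x - y)\<^sup>2"
    using assms by simp
  moreover have "x * (y ^ Suc n + real (Suc n) * y ^ n * (x - y)) \<le> x * x ^ Suc n"
    using Suc.IH assms by (intro mult_left_mono) auto
  ultimately show ?case
    by (simp add: algebra_simps power2_eq_square)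
qed

text \<open>
  The gap between \<open>t\<close> and \<open>psi\<close>. A law with second atom \<open>s\<close> and smallest atom \<open>m\<close> lies in
  the body iff \<open>s - m \<le> defect n s\<close>; this form is convenient because \<open>defect\<close> is increasing on
  the whole unit interval, whereas \<open>psi\<close> is not.
\<close>

definition defect :: "nat \<Rightarrow> real \<Rightarrow> real" where
  "defect n t = t - psi (Suc n) t"

lemma psi_Suc: "psi (Suc n) t = ((1 - t) - (1 - t) ^ Suc n) / real n"
  by (simp add: psi_def)

lemma psi_le_iff:
  assumes "n > 0"
  shows "psi (Suc n) t \<le> m \<longleftrightarrow> (1 - t) - real n * m \<le> (1 - t) ^ Suc n"
  using assms by (simp add: psi_Suc field_simps del: power_Suc)

lemma defect_eq:
  assumes "n > 0"
  shows "real n * defect n t = real n - real (Suc n) * (1 - t) + (1 - t) ^ Suc n"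
  using assms by (simp add: defect_def psi_Suc field_simps del: power_Suc)

text \<open>
  The hypothesis on \<open>b\<close> says that the slope of the concave function \<open>psi\<close> is nonnegative at
  \<open>b\<close>, hence to the left of it.
\<close>

lemma psi_mono:
  assumes "n > 0" "a \<le> b" "b \<le> 1" "1 \<le> real (Suc n) * (1 - b) ^ n"
  shows "psi (Suc n) a \<le> psi (Suc n) b"
proof -
  have "(1 - b) ^ Suc n + real (Suc n) * (1 - b) ^ n * (b - a) \<le> (1 - a) ^ Suc n"
    using power_ge_tangent[of "1 - a" "1 - b" n] assms by simp
  moreover have "1 * (b - a) \<le> real (Suc n) * (1 - b) ^ n * (b - a)"
    using assms by (intro mult_right_mono) auto
  ultimately have "(1 - a) - (1 - a) ^ Suc n \<le> (1 - b) - (1 - b) ^ Suc n"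
    by (simp del: power_Suc of_nat_Suc)
  then show ?thesis
    using assms by (simp add: psi_Suc divide_right_mono del: power_Suc)
qed

lemma psi_nonneg:
  assumes "0 \<le> t" "t \<le> 1"
  shows "0 \<le> psi (Suc n) t"
proof -
  have "(1 - t) ^ Suc n \<le> 1 - t"
    using power_decreasing[of 1 "Suc n" "1 - t"] assms by simp
  then show ?thesis by (simp add: psi_Suc)
qed

lemma defect_mono:
  assumes "n > 0" "0 \<le> a" "a \<le> b" "b \<le> 1"
  shows "defect n a \<le> defect n b"
proof -
  have "(1 - a) ^ Suc n + real (Suc n) * (1 - a) ^ n * (a - b) \<le> (1 - b) ^ Suc n"
    using power_ge_tangent[of "1 - b" "1 - a" n] assms by simp
  moreover have "real (Suc n) * (1 - a) ^ n * (b - a) \<le> real (Suc n) * (b - a)"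
    using assms by (intro mult_right_mono mult_left_le power_le_one) auto
  ultimately have "real n * defect n a \<le> real n * defect n b"
    using assms by (simp add: defect_eq algebra_simps del: power_Suc)
  then show ?thesis using assms by simp
qed

lemma defect_rec:
  assumes "n > 0"
  shows "real (Suc n) * defect (Suc n) t = real n * defect n t + t * (1 - (1 - t) ^ Suc n)"
  using assms by (subst (1 2) defect_eq) (auto simp: algebra_simps)

lemma defect_1: "defect (Suc 0) t = t\<^sup>2"
  by (simp add: defect_def psi_def power2_eq_square algebra_simps)

text \<open>
  \<open>n * defect n s\<close> is the sum over \<open>j = 1, ..., n\<close> of \<open>s * (1 - (1 - s) ^ j)\<close>, which is what
  \<open>defect_rec\<close> says one summand at a time, and \<open>1 - (1 - s) ^ j\<close> is concave in \<open>s\<close> and vanishes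
  at 0. So shrinking \<open>s\<close> by \<open>b\<close> costs each summand a factor of at most \<open>b\<^sup>2\<close>.
\<close>

lemma defect_scale:
  assumes "n > 0" "0 \<le> b" "b \<le> 1" "0 \<le> s" "s \<le> 1"
  shows "b\<^sup>2 * defect n s \<le> defect n (b * s)"
proof -
  have "b\<^sup>2 * (real n * defect n s) \<le> real n * defect n (b * s)"
    using \<open>n > 0\<close>
  proof (induction n rule: nat_induct_non_zero)
    case 1
    then show ?case using assms by (simp add: defect_1 power_mult_distrib)
  next
    case (Suc n)
    have pow: "(1 - b * s) ^ j \<le> 1 - b + b * (1 - s) ^ j" for j
    proof (induction j)
      case (Suc j)
      have bs: "b * s \<le> 1" using assms by (simp add: mult_le_one)
      have "(1 - b * s) * (1 - b * s) ^ j \<le> (1 - b * s) * (1 - b + b * (1 - s) ^ j)"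
        using Suc.IH bs by (intro mult_left_mono) auto
      also have "\<dots> = 1 - b + b * (1 - s) ^ Suc j - b * (1 - b) * s * (1 - (1 - s) ^ j)"
        by (simp add: algebra_simps)
      also have "\<dots> \<le> 1 - b + b * (1 - s) ^ Suc j"
        using assms by (simp add: power_le_one)
      finally show ?case by simp
    qed simp
    have "b * s * (b * (1 - (1 - s) ^ Suc n)) \<le> b * s * (1 - (1 - b * s) ^ Suc n)"
      using pow[of "Suc n"] assms by (intro mult_left_mono) (auto simp: algebra_simps)
    moreover have "b\<^sup>2 * (real (Suc n) * defect (Suc n) s) =
        b\<^sup>2 * (real n * defect n s) + b * s * (b * (1 - (1 - s) ^ Suc n))"
      using Suc.hyps by (simp only: defect_rec) (simp add: algebra_simps power2_eq_square)
    ultimately show ?case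
      using Suc by (simp only: defect_rec)
  qed
  then have "real n * (b\<^sup>2 * defect n s) \<le> real n * defect n (b * s)"
    by (simp add: algebra_simps)
  then show ?thesis using assms by simp
qed

lemma defect_nonneg:
  assumes "n > 0" "0 \<le> t" "t \<le> 1"
  shows "0 \<le> defect n t"
  using defect_scale[of n 0 t] defect_mono[of n 0 t] assms by (simp add: defect_def psi_def)

lemma defect_upper:
  assumes "n > 0" "0 \<le> t" "t \<le> 1"
  shows "real n * defect n t \<le> real n * real (Suc n) / 2 * t\<^sup>2"
  using \<open>n > 0\<close>
proof (induction n rule: nat_induct_non_zero)
  case 1
  then show ?case by (simp add: defect_1)
next
  case (Suc n)
  have "1 - real (Suc n) * t \<le> (1 - t) ^ Suc n"
    using power_ge_tangent[of "1 - t" 1 n] assms by simp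
  then have "t * (1 - (1 - t) ^ Suc n) \<le> t * (real (Suc n) * t)"
    using assms by (intro mult_left_mono) auto
  then show ?case
    using Suc by (subst defect_rec) (auto simp: field_simps power2_eq_square)
qed

section \<open>The second atom of a law in the body\<close>

lemma power_two_over_le:
  assumes "n \<ge> 3"
  shows "(1 + 2 / real (Suc n)) ^ n \<le> real (Suc n)"
proof -
  consider "n = 3" | "n = 4" | "n = 5" | "n = 6" | "n \<ge> 7" using assms by linarith
  then show ?thesis
  proof cases
    case 5
    have "1 + 2 / real (Suc n) \<le> exp (2 / real (Suc n))" by (rule exp_ge_add_one_self)
    then have "(1 + 2 / real (Suc n)) ^ n \<le> exp (2 / real (Suc n)) ^ n"
      by (intro power_mono) auto
    also have "\<dots> = exp (real n * (2 / real (Suc n)))"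
      by (rule exp_of_nat_mult[symmetric])
    also have "\<dots> \<le> exp 2" by (simp add: field_simps)
    also have "exp 2 = exp (1::real) * exp 1" by (simp flip: exp_add)
    also have "\<dots> \<le> (272 / 100) * (272 / 100)"
      using e_less_272 by (intro mult_mono) auto
    also have "\<dots> \<le> real (Suc n)" using 5 by simp
    finally show ?thesis .
  qed (simp_all add: field_simps power_def)
qed

lemma second_atom_power:
  assumes n: "n \<ge> 3" and s: "0 \<le> s" "2 * s + (real n - 1) * m \<le> 1" "psi (Suc n) s \<le> m"
  shows "real n - real (Suc n) * (1 - s) \<le> (real n - 1) * (1 - s) ^ Suc n"
proof -
  have "(1 - s) - real n * m \<le> (1 - s) ^ Suc n"
    using psi_le_iff[of n s m] assms by simp
  then have "(real n - 1) * ((1 - s) - real n * m) \<le> (real n - 1) * (1 - s) ^ Suc n"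
    using n by (intro mult_left_mono) auto
  moreover have "real n * (2 * s + (real n - 1) * m) \<le> real n * 1"
    using s by (intro mult_left_mono) auto
  ultimately show ?thesis by (simp add: algebra_simps)
qed

text \<open>
  The second atom of a law in the body stays to the left of the maximum of \<open>psi\<close>. The reason is
  a lack of mass: the two largest atoms are at least \<open>s\<close> and the other \<open>n - 1\<close> are at least
  \<open>psi (Suc n) s\<close>, and a second atom beyond the maximum would already give a total above 1. This
  makes \<open>psi\<close> increasing wherever it will be evaluated.
\<close>

lemma second_atom_bound:
  assumes n: "n \<ge> 3" and s: "0 \<le> s" "s \<le> 1 / 2" "2 * s + (real n - 1) * m \<le> 1" "psi (Suc n) s \<le> m"
  shows "1 \<le> real (Suc n) * (1 - s) ^ n"
proof (rule ccontr)
  define k where "k = real (Suc n)"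
  have k: "real n = k - 1" "k \<ge> 4" using n by (auto simp: k_def)
  assume "\<not> ?thesis"
  then have less: "k * (1 - s) ^ n < 1" by (simp add: k_def)
  have "(1 - s) * (k * (1 - s) ^ n) \<le> (1 - s) * 1"
    using less s by (intro mult_left_mono) auto
  then have "(k - 2) * (k * (1 - s) ^ Suc n) \<le> (k - 2) * (1 - s)"
    using k by (intro mult_left_mono) (auto simp: algebra_simps)
  moreover have "k * (k - 1 - k * (1 - s)) \<le> k * ((k - 2) * (1 - s) ^ Suc n)"
    using second_atom_power[OF n s(1,3,4), folded k_def] k by (intro mult_left_mono) auto
  ultimately have "k * (k - 1 - k * (1 - s)) \<le> (k - 2) * (1 - s)"
    by (simp add: algebra_simps)
  then have "(k - 1) * k \<le> (k - 1) * ((k + 2) * (1 - s))" by (simp add: algebra_simps)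
  then have "k \<le> (k + 2) * (1 - s)" using k by (subst (asm) mult_le_cancel_left_pos) auto
  then have "1 \<le> (1 + 2 / k) * (1 - s)" using k by (simp add: field_simps)
  then have "1 \<le> ((1 + 2 / k) * (1 - s)) ^ n" by (rule one_le_power)
  also have "\<dots> = (1 + 2 / k) ^ n * (1 - s) ^ n" by (rule power_mult_distrib)
  also have "\<dots> \<le> k * (1 - s) ^ n"
    using power_two_over_le[OF n] s by (intro mult_right_mono) (auto simp: k_def)
  finally show False using less by simp
qed

section \<open>Multiplying the conditions of two laws\<close>

text \<open>
  With \<open>u = 1 - s\<close> the condition \<open>psi (Suc n) s \<le> m\<close> reads \<open>u - n * m \<le> u ^ Suc n\<close>, and this form
  is multiplicative: multiplying it for two laws gives
  \<open>u * u' - n * (m * u' + m' * u - n * m * m') \<le> (u * u') ^ Suc n\<close>, that is,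
  \<open>psi (1 - u * u') \<le> m * u' + m' * u - n * m * m'\<close>. By monotonicity of \<open>psi\<close> one may replace \<open>u\<close> by
  any \<open>a\<close> between \<open>1 - s\<close> and \<open>1 - z\<close>, and \<open>u'\<close> by any such \<open>b\<close>. The products \<open>a * b\<close> fill the whole
  interval between the extreme values, so every \<open>v\<close> in the stated range is reached.
\<close>

lemma psi_le_product_bound:
  assumes n: "n > 0"
    and z: "0 \<le> z" "z \<le> s" "0 \<le> z'" "z' \<le> s'"
    and s: "s < 1" "1 \<le> real (Suc n) * (1 - s) ^ n" "psi (Suc n) s \<le> m" "s + real n * m \<le> 1" "0 \<le> m"
    and s': "s' < 1" "1 \<le> real (Suc n) * (1 - s') ^ n" "psi (Suc n) s' \<le> m'" "s' + real n * m' \<le> 1" "0 \<le> m'"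
    and v: "z + z' - z * z' \<le> v" "v \<le> s + s' - s * s'"
  shows "psi (Suc n) v \<le> m * (1 - z') + m' * (1 - z) - real n * m * m'"
proof -
  have v': "(1 - s) * (1 - s') \<le> 1 - v" "1 - v \<le> (1 - z) * (1 - z')"
    using v by (auto simp: algebra_simps)
  obtain a b where ab: "1 - s \<le> a" "a \<le> 1 - z" "1 - s' \<le> b" "b \<le> 1 - z'" "a * b = 1 - v"
  proof (cases "(1 - s) * (1 - z') \<le> 1 - v")
    case True
    have "0 < 1 - z'" using z s' by auto
    then show ?thesis
      using that[of "(1 - v) / (1 - z')" "1 - z'"] True v' z
      by (auto simp: field_simps)
  next
    case False
    have "0 < 1 - s" using s by auto
    then show ?thesis
      using that[of "1 - s" "(1 - v) / (1 - s)"] False v' z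
      by (auto simp: field_simps)
  qed
  have "psi (Suc n) (1 - a) \<le> m"
    using psi_mono[of n "1 - a" s] n s ab by auto
  then have a: "a - real n * m \<le> a ^ Suc n" "0 \<le> a - real n * m"
    using psi_le_iff[of n "1 - a" m] n s ab by auto
  have "psi (Suc n) (1 - b) \<le> m'"
    using psi_mono[of n "1 - b" s'] n s' ab by auto
  then have b: "b - real n * m' \<le> b ^ Suc n" "0 \<le> b - real n * m'"
    using psi_le_iff[of n "1 - b" m'] n s' ab by auto
  have "(a - real n * m) * (b - real n * m') \<le> a ^ Suc n * b ^ Suc n"
    using a b by (intro mult_mono) auto
  also have "\<dots> = (1 - v) ^ Suc n"
    using ab by (metis power_mult_distrib)
  finally have "a * b - real n * (m * b + m' * a - real n * m * m') \<le> (1 - v) ^ Suc n"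
    by (simp add: algebra_simps del: power_Suc)
  then have "psi (Suc n) v \<le> m * b + m' * a - real n * m * m'"
    using psi_le_iff[of n v] n ab by simp
  moreover have "m * b \<le> m * (1 - z')" "m' * a \<le> m' * (1 - z)"
    using ab s s' by (auto intro: mult_left_mono)
  ultimately show ?thesis by linarith
qed

section \<open>From the largest atom to the second one\<close>

text \<open>
  If \<open>p\<close> lies on the increasing branch of \<open>psi\<close> this is monotonicity. Otherwise \<open>p\<close> is large and
  little mass \<open>u = 1 - p\<close> is left for \<open>t\<close>: with all of it spent, \<open>t\<close> is at most
  \<open>t0 = (u + (n - 1) * u ^ Suc n) / n\<close>, and the claim for \<open>t0\<close> is \<open>u ^ Suc n \<le> defect n t0\<close>. Let \<open>1 - w\<close>
  be the maximum point of \<open>psi\<close>, so that the maximal value is \<open>w / k\<close> for \<open>k = n + 1\<close>. Then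
  \<open>t1 = 2 * w / k\<close> has defect at least \<open>w / k\<close>, and \<open>defect_scale\<close> carries this bound down from \<open>t1\<close>
  to \<open>t0\<close>.
\<close>

lemma psi_second_of_psi_first:
  assumes n: "n \<ge> 3"
    and t: "0 \<le> t" "t \<le> p" "p + t + (real n - 1) * m \<le> 1"
    and m: "psi (Suc n) p \<le> m" "0 \<le> m"
  shows "psi (Suc n) t \<le> m"
proof (cases "1 \<le> real (Suc n) * (1 - p) ^ n \<or> p = 1")
  case True
  have "p \<le> 1" using t m n mult_nonneg_nonneg[of "real n - 1" m] by linarith
  show ?thesis
  proof (cases "p = 1")
    case True
    then have "t = 0" using t m n mult_nonneg_nonneg[of "real n - 1" m] by linarith
    then show ?thesis using m by (simp add: psi_def)
  next
    case False
    then show ?thesis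
      using True psi_mono[of n t p] n t m \<open>p \<le> 1\<close> by force
  qed
next
  case False
  define k where "k = real (Suc n)"
  have k: "real n = k - 1" "k \<ge> 4" using n by (auto simp: k_def)
  have "p \<le> 1" using t m n mult_nonneg_nonneg[of "real n - 1" m] by linarith
  define u where "u = 1 - p"
  have u: "u > 0" "u \<le> 1" "k * u ^ n < 1"
    using False \<open>p \<le> 1\<close> t by (auto simp: u_def k_def)
  define w where "w = root n (1 / k)"
  have w: "w > 0" "k * w ^ n = 1"
    using n k by (auto simp: w_def)
  have "u < w"
    using u w k by (metis mult_less_cancel_left_pos less_le_trans linorder_not_less order_less_le
        power_mono zero_less_numeral)
  define Y where "Y = k * u ^ n"
  have Y: "0 < Y" "Y < 1" using u k by (auto simp: Y_def)
  have Y': "u ^ Suc n = u * Y / k" using k by (simp add: Y_def)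
  define t0 where "t0 = u * (k + (k - 2) * Y) / (k * (k - 1))"
  have m0: "u - (k - 1) * m \<le> u ^ Suc n"
    using psi_le_iff[of n p m] m n k by (simp add: u_def)
  have "(k - 1) * t \<le> (k - 1) * (u - (k - 2) * m)"
    using t k by (intro mult_left_mono) (auto simp: u_def)
  also have "\<dots> \<le> (k - 1) * u - (k - 2) * (u - u ^ Suc n)"
    using mult_left_mono[OF m0, of "k - 2"] k by (simp add: algebra_simps)
  also have "\<dots> = (k - 1) * t0"
    unfolding Y' using k by (simp add: t0_def field_simps)
  finally have "t \<le> t0" using k by simp
  have "t0 > 0" using u k Y by (simp add: t0_def add_pos_pos)
  define t1 where "t1 = 2 * w / k"
  have "t1 > 0" using w k by (simp add: t1_def)
  have "t0 \<le> t1"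
  proof -
    have "u * (k + (k - 2) * Y) \<le> w * (k + (k - 2) * 1)"
      using \<open>u < w\<close> w Y k by (intro mult_mono add_left_mono mult_left_mono) auto
    then have "t0 \<le> w * (k + (k - 2) * 1) / (k * (k - 1))"
      using k unfolding t0_def by (intro divide_right_mono) auto
    also have "\<dots> = t1" using k by (simp add: t1_def field_simps)
    finally show ?thesis .
  qed
  have "t1 \<le> 1 - w"
  proof -
    have "((1 + 2 / k) * w) ^ n \<le> k * w ^ n"
      using power_two_over_le[OF n] w unfolding power_mult_distrib
      by (intro mult_right_mono) (auto simp: k_def)
    then have "((1 + 2 / k) * w) ^ n \<le> 1 ^ n" using w by simp
    then have "(1 + 2 / k) * w \<le> 1"
      using n by (subst (asm) power_mono_iff) (use w k in auto)
    then show ?thesis using k by (simp add: t1_def field_simps)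
  qed
  have crit: "1 \<le> real (Suc n) * (1 - (1 - w)) ^ n" using w by (simp add: k_def)
  have "w \<le> 1" using \<open>t1 > 0\<close> \<open>t1 \<le> 1 - w\<close> by linarith
  have "psi (Suc n) t1 \<le> psi (Suc n) (1 - w)"
    using psi_mono[OF _ \<open>t1 \<le> 1 - w\<close> _ crit] n w by simp
  also have "\<dots> = w / k"
  proof -
    have "w ^ Suc n = w / k" using w k by (simp add: field_simps)
    then have "psi (Suc n) (1 - w) = (w - w / k) / (k - 1)" using k by (simp add: psi_Suc)
    also have "\<dots> = w / k" using k by (simp add: field_simps)
    finally show ?thesis .
  qed
  finally have "w / k \<le> defect n t1" by (simp add: defect_def t1_def)
  then have "(t0 / t1)\<^sup>2 * (w / k) \<le> (t0 / t1)\<^sup>2 * defect n t1"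
    by (intro mult_left_mono) auto
  also have "\<dots> \<le> defect n (t0 / t1 * t1)"
    using \<open>t0 > 0\<close> \<open>t0 \<le> t1\<close> \<open>t1 \<le> 1 - w\<close> w n by (intro defect_scale) auto
  finally have J: "(t0 / t1)\<^sup>2 * (w / k) \<le> defect n t0"
    using \<open>t1 > 0\<close> by simp
  have "u * Y / k \<le> (t0 / t1)\<^sup>2 * (w / k)"
  proof -
    define a where "a = 1 + (k - 2) * Y"
    have "0 < a" using k Y by (simp add: a_def add_pos_nonneg)
    \<comment> \<open>With \<open>Y = (u / w) ^ n\<close> the claim becomes \<open>u * (k - 1 + a)\<^sup>2 \<ge> 4 * (k - 1)\<^sup>2 * w * Y\<close>. It
      combines the inequality of the means with the Bernoulli inequality for \<open>w / u\<close>.\<close>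
    have square: "4 * (k - 1) * a \<le> (k - 1 + a)\<^sup>2"
      using zero_le_power2[of "k - 1 - a"] by (simp add: power2_eq_square algebra_simps)
    have "(w / u) ^ n * Y = 1" using w u by (simp add: Y_def power_divide field_simps)
    moreover have "1 + real n * (w / u - 1) \<le> (w / u) ^ n"
      using Bernoulli_inequality[of "w / u - 1" n] u w by simp
    ultimately have "(1 + real n * (w / u - 1)) * Y \<le> 1"
      using Y by (metis mult_right_mono less_imp_le)
    then have "(k - 1) * w * Y \<le> u * a"
      using u k by (simp add: a_def field_simps)
    then have "4 * (k - 1) * ((k - 1) * w * Y) \<le> 4 * (k - 1) * (u * a)"
      using k by (intro mult_left_mono) auto
    also have "\<dots> \<le> u * (k - 1 + a)\<^sup>2"
      using mult_left_mono[OF square, of u] u by (simp add: mult.commute mult.left_commute)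
    also have "k - 1 + a = k + (k - 2) * Y" by (simp add: a_def)
    also have "4 * (k - 1) * ((k - 1) * w * Y) = 4 * (k - 1)\<^sup>2 * w * Y"
      by (simp only: power2_eq_square mult_ac)
    finally have "4 * (k - 1)\<^sup>2 * w * Y \<le> u * (k + (k - 2) * Y)\<^sup>2" .
    then have "u * (4 * (k - 1)\<^sup>2 * w * Y) \<le> u * (u * (k + (k - 2) * Y)\<^sup>2)"
      using u by (intro mult_left_mono) auto
    then have "u * (4 * (k - 1)\<^sup>2 * w * Y) / (4 * (k - 1)\<^sup>2 * k * w) \<le>
        u * (u * (k + (k - 2) * Y)\<^sup>2) / (4 * (k - 1)\<^sup>2 * k * w)"
      using k w by (intro divide_right_mono) auto
    also have "\<dots> = (t0 / t1)\<^sup>2 * (w / k)"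
    proof -
      define q B where "q = k + (k - 2) * Y" and "B = k - 1"
      have "B > 0" using k by (simp add: B_def)
      then have "u * (u * q\<^sup>2) / (4 * B\<^sup>2 * k * w) = (u * q / (2 * B * w))\<^sup>2 * (w / k)"
        using k w by (simp add: power2_eq_square field_simps)
      moreover have "t0 / t1 = u * q / (2 * B * w)"
        using k w by (simp add: t0_def t1_def q_def B_def)
      ultimately show ?thesis by (simp only: q_def B_def)
    qed
    also have "u * (4 * (k - 1)\<^sup>2 * w * Y) / (4 * (k - 1)\<^sup>2 * k * w) = u * Y / k"
      using k w by simp
    finally show ?thesis .
  qed
  then have "u ^ Suc n \<le> defect n t0" using J Y' by simp
  then have "psi (Suc n) t0 \<le> t0 - u * Y / k" unfolding defect_def Y' by linarith
  also have "\<dots> \<le> m"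
  proof -
    have "k * (k - 1) * (t0 - u * Y / k) = k * (k - 1) * t0 - (k - 1) * (k * (u * Y / k))"
      by (simp only: right_diff_distrib left_diff_distrib mult_ac)
    also have "k * (u * Y / k) = u * Y" using k by simp
    also have "k * (k - 1) * t0 = u * (k + (k - 2) * Y)" using k by (simp add: t0_def)
    also have "u * (k + (k - 2) * Y) - (k - 1) * (u * Y) = k * (u - u * Y / k)"
      using k by (simp add: algebra_simps)
    also have "\<dots> \<le> k * ((k - 1) * m)"
      using m0 k unfolding Y' by (intro mult_left_mono) auto
    finally have "k * (k - 1) * (t0 - u * Y / k) \<le> k * (k - 1) * m" by (simp only: mult.assoc)
    then show ?thesis using k by (subst (asm) mult_le_cancel_left_pos) auto
  qed
  finally have "psi (Suc n) t0 \<le> m" .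
  moreover have "psi (Suc n) t \<le> psi (Suc n) t0"
  proof (rule psi_mono)
    have "w \<le> 1 - t0" using \<open>t0 \<le> t1\<close> \<open>t1 \<le> 1 - w\<close> by simp
    then have "k * w ^ n \<le> k * (1 - t0) ^ n" using k w by (intro mult_left_mono power_mono) auto
    then show "1 \<le> real (Suc n) * (1 - t0) ^ n" unfolding w by (simp only: k_def)
    show "t0 \<le> 1" using \<open>w \<le> 1 - t0\<close> w by simp
  qed (use n \<open>t \<le> t0\<close> in auto)
  ultimately show ?thesis by simp
qed

section \<open>A convolution semigroup and its flow\<close>

text \<open>
  The right-hand side at \<open>u = 1 - t\<close> is \<open>n * (defect t + t * psi' t - psi t)\<close>: the gap at 0 below the
  tangent of \<open>psi\<close> at \<open>t\<close> never exceeds the defect. Passing from \<open>n\<close> to \<open>n + 1\<close> adds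
  \<open>1 - u\<close> times the error of the tangent of \<open>x ^ Suc n\<close> at \<open>u\<close>, evaluated at 1.
\<close>

lemma tangent_gap_le_defect:
  fixes u :: real
  assumes "0 \<le> u" "u \<le> 1"
  shows "0 \<le> (real n - 1) - real (Suc n) * u + real (Suc n) * u ^ n - (real n - 1) * u ^ Suc n"
proof (induction n)
  case (Suc n)
  have "0 \<le> (1 - u) * (1 - real (Suc n) * u ^ n + real n * u ^ Suc n)"
    using power_ge_tangent[of 1 u n] assms by (intro mult_nonneg_nonneg) (auto simp: algebra_simps)
  then show ?case using Suc by (simp add: algebra_simps)
qed (use assms in auto)

text \<open>
  For \<open>0 < b \<le> 1\<close> consider the law with mass \<open>1 - b\<close> at zero, an extra mass \<open>b ^ Suc n\<close> at one, and the
  floor \<open>(b - b ^ Suc n) / n = psi (1 - b)\<close> at every unit. Under multiplicative convolution these laws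
  form a semigroup in \<open>b\<close>, and they act linearly on the triple of second atom \<open>S\<close>, smallest atom \<open>M\<close> and
  total mass of the units. Starting from an extremal law, \<open>M = psi S\<close>, whose mass on the units is the
  least possible value \<open>s + (n - 1) * psi s\<close>, the flow must stay in the region \<open>psi S \<le> M\<close>; this is
  the claim. It is checked infinitesimally: where \<open>H = M - psi S\<close> is negative, \<open>H\<close> decreases in \<open>b\<close>, so
  \<open>H\<close> could not return to its value 0 at \<open>b = 1\<close>.
\<close>

lemma defect_flow:
  assumes n: "n \<ge> 3" and s: "0 \<le> s" "s \<le> 1" "1 \<le> real (Suc n) * (1 - s) ^ n"
    and b: "0 < b" "b \<le> 1"
  shows "b ^ Suc n * defect n s \<le>
    defect n (b ^ Suc n * s + (b - b ^ Suc n) / real n * (s + (real n - 1) * psi (Suc n) s))"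
proof (rule ccontr)
  define k where "k = real (Suc n)"
  have k: "real n = k - 1" "k \<ge> 4" using n by (auto simp: k_def)
  define c where "c = s + (k - 2) * psi (Suc n) s"
  define S where "S = (\<lambda>b. b ^ Suc n * s + (b - b ^ Suc n) / (k - 1) * c)"
  define M where "M = (\<lambda>b. b ^ Suc n * psi (Suc n) s + (b - b ^ Suc n) / (k - 1) * c)"
  define H where "H = (\<lambda>b. M b - psi (Suc n) (S b))"
  assume "\<not> ?thesis"
  then have "defect n (S b) < b ^ Suc n * defect n s"
    by (simp add: S_def c_def k)
  also have "\<dots> = S b - M b"
    by (simp add: defect_def S_def M_def algebra_simps)
  finally have neg: "H b < 0" by (simp add: H_def defect_def)
  have psi0: "0 \<le> psi (Suc n) s" "psi (Suc n) s \<le> s"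
    using psi_nonneg[of s n] defect_nonneg[of n s] s n by (auto simp: defect_def)
  have c: "0 \<le> c" "c \<le> (k - 1) * s"
  proof -
    show "0 \<le> c" using psi0 s k by (simp add: c_def)
    have "(k - 2) * psi (Suc n) s \<le> (k - 2) * s" using psi0 k by (intro mult_left_mono) auto
    then show "c \<le> (k - 1) * s" by (simp add: c_def algebra_simps)
  qed
  define p' where "p' = (\<lambda>x. (k * (1 - x) ^ n - 1) / (k - 1))"
  define H' where "H' = (\<lambda>x. (k * x ^ n * psi (Suc n) s + (1 - k * x ^ n) / (k - 1) * c)
      - p' (S x) * (k * x ^ n * s + (1 - k * x ^ n) / (k - 1) * c))"
  have psi_deriv: "(psi (Suc n) has_real_derivative p' x) (at x)" for x
    unfolding psi_Suc p'_def using k n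
    by (auto intro!: derivative_eq_intros simp: k_def field_simps simp del: power_Suc)
  have S_deriv: "(S has_real_derivative k * x ^ n * s + (1 - k * x ^ n) / (k - 1) * c) (at x)" for x
    unfolding S_def using k
    by (auto intro!: derivative_eq_intros simp: k_def simp del: power_Suc)
  have M_deriv: "(M has_real_derivative k * x ^ n * psi (Suc n) s + (1 - k * x ^ n) / (k - 1) * c) (at x)" for x
    unfolding M_def using k
    by (auto intro!: derivative_eq_intros simp: k_def simp del: power_Suc)
  have H_deriv: "(H has_real_derivative H' x) (at x)" for x
    unfolding H_def H'_def
    by (intro DERIV_diff M_deriv DERIV_chain2[OF psi_deriv S_deriv])
  have decreasing: "H' x < 0" if x: "0 < x" "x \<le> 1" "H x < 0" for x
  proof -
    have xp: "0 < x ^ Suc n" "x ^ Suc n \<le> x"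
      using x power_decreasing[of 1 "Suc n" x] by auto
    have S0: "0 \<le> S x" using xp s c k by (simp add: S_def)
    have "(x - x ^ Suc n) / (k - 1) * c \<le> (x - x ^ Suc n) / (k - 1) * ((k - 1) * s)"
      using xp c k by (intro mult_left_mono) auto
    also have "\<dots> = (x - x ^ Suc n) * s" using k by simp
    finally have "S x \<le> x * s" unfolding S_def by (simp add: algebra_simps)
    moreover have "x * s \<le> 1 * s" using x s by (intro mult_right_mono) auto
    ultimately have "S x \<le> s" by simp
    have "k * (1 - s) ^ n \<le> k * (1 - S x) ^ n"
      using \<open>S x \<le> s\<close> s k by (intro mult_left_mono power_mono) auto
    then have "1 \<le> k * (1 - S x) ^ n" using s(3)[folded k_def] by (rule order.trans[rotated])
    then have p0: "0 \<le> p' (S x)" using k by (simp add: p'_def)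
    \<comment> \<open>The relation \<open>c = s + (k - 2) * psi s\<close> between the data persists along the flow, with \<open>x * c\<close>
      for the mass of the units. It turns the derivative into an expression in \<open>S x\<close> and \<open>M x\<close>.\<close>
    define D where "D = (x - x ^ Suc n) / (k - 1)"
    have D: "(k - 1) * D = x - x ^ Suc n" using k by (simp add: D_def)
    have SM: "S x = x ^ Suc n * s + D * c" "M x = x ^ Suc n * psi (Suc n) s + D * c"
      by (simp_all add: S_def M_def D_def)
    have "S x + (k - 2) * M x = x ^ Suc n * c + ((k - 1) * D) * c"
      unfolding SM by (simp add: c_def algebra_simps del: power_Suc)
    then have inv: "x * c = S x + (k - 2) * M x"
      unfolding D by (simp add: algebra_simps)
    define Q where "Q = (1 - k * x ^ n) / (k - 1)"
    have xQ: "x * Q = k * D - x"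
    proof -
      have "(k - 1) * (x * Q) = x * (1 - k * x ^ n)"
        using k by (simp add: Q_def)
      also have "\<dots> = k * ((k - 1) * D) - (k - 1) * x"
        unfolding D by (simp add: algebra_simps)
      also have "\<dots> = (k - 1) * (k * D - x)" by (simp add: algebra_simps)
      finally show ?thesis using k by (subst (asm) mult_cancel_left) auto
    qed
    have "x * H' x = (k * x ^ Suc n * psi (Suc n) s + x * Q * c)
        - p' (S x) * (k * x ^ Suc n * s + x * Q * c)"
      unfolding H'_def Q_def[symmetric] by (simp add: algebra_simps)
    also have "\<dots> = (k * M x - x * c) - p' (S x) * (k * S x - x * c)"
      unfolding SM xQ by (simp add: algebra_simps)
    finally have xH': "x * H' x = (k * M x - x * c) - p' (S x) * (k * S x - x * c)" .
    define P where "P = psi (Suc n) (S x)"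
    have M: "M x = P + H x" by (simp add: H_def P_def)
    have "S x * p' (S x) + defect n (S x) - P \<ge> 0"
    proof -
      have "(k - 1) * (S x * p' (S x) + defect n (S x) - P) =
        (k - 2) - k * (1 - S x) + k * (1 - S x) ^ n - (k - 2) * (1 - S x) ^ Suc n"
      proof -
        have 1: "(k - 1) * p' (S x) = k * (1 - S x) ^ n - 1" using k by (simp add: p'_def)
        have 2: "(k - 1) * P = (1 - S x) - (1 - S x) ^ Suc n"
          using k by (simp add: P_def psi_Suc del: power_Suc)
        have "(k - 1) * (S x * p' (S x) + defect n (S x) - P) =
            S x * ((k - 1) * p' (S x)) + (k - 1) * S x - 2 * ((k - 1) * P)"
          unfolding defect_def P_def[symmetric] by (simp add: algebra_simps)
        also have "\<dots> = (k - 2) - k * (1 - S x) + k * (1 - S x) ^ n - (k - 2) * (1 - S x) ^ Suc n"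
          unfolding 1 2 by (simp add: algebra_simps)
        finally show ?thesis .
      qed
      also have "0 \<le> \<dots>"
        using tangent_gap_le_defect[of "1 - S x" n, folded k_def] S0 \<open>S x \<le> s\<close> s
        by (simp only: k) simp
      finally show ?thesis using k by (simp only: zero_le_mult_iff) linarith
    qed
    moreover have "0 \<le> defect n (S x)"
      using defect_nonneg[of n "S x"] S0 \<open>S x \<le> s\<close> s n by simp
    then have "0 \<le> (k - 2) * p' (S x) * defect n (S x)" using p0 k by simp
    moreover have "(2 + (k - 2) * p' (S x)) * H x < 0"
      using p0 k x by (intro mult_pos_neg add_pos_nonneg) auto
    moreover have "x * H' x = (2 + (k - 2) * p' (S x)) * H x
        - (k - 2) * p' (S x) * defect n (S x) - (S x * p' (S x) + defect n (S x) - P)"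
      unfolding xH' inv M defect_def P_def[symmetric] by (simp add: algebra_simps)
    ultimately have "x * H' x < 0" by linarith
    then show ?thesis using x by (simp add: mult_less_0_iff)
  qed
  have "H 1 = 0" by (simp add: H_def M_def S_def)
  have cont: "continuous_on A H" for A
    using H_deriv by (meson DERIV_isCont continuous_at_imp_continuous_on)
  \<comment> \<open>Between \<open>b\<close> and the first zero \<open>r\<close> of \<open>H\<close>, the function is negative, hence decreasing.\<close>
  define Z where "Z = {x \<in> {b..1}. H x = 0}"
  have "closed Z"
    unfolding Z_def by (rule continuous_closed_preimage_constant[OF cont]) simp
  moreover have "1 \<in> Z" using b \<open>H 1 = 0\<close> by (simp add: Z_def)
  moreover have bdd: "bdd_below Z" by (auto simp: Z_def bdd_below_def)
  ultimately have "Inf Z \<in> Z" by (intro closed_contains_Inf) auto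
  define r where "r = Inf Z"
  have r: "b \<le> r" "r \<le> 1" "H r = 0" using \<open>Inf Z \<in> Z\<close> by (auto simp: Z_def r_def)
  have "b < r" using r neg by (cases "b = r") auto
  have below: "H x < 0" if x: "b \<le> x" "x < r" for x
  proof (rule ccontr)
    assume "\<not> H x < 0"
    then obtain y where "b \<le> y" "y \<le> x" "H y = 0"
      using IVT'[of H b 0 x] neg x cont by force
    then have "y \<in> Z" using x r by (simp add: Z_def)
    then have "r \<le> y" unfolding r_def by (rule cInf_lower) (rule bdd)
    then show False using \<open>y \<le> x\<close> x by simp
  qed
  obtain x where x: "b < x" "x < r" "H r - H b = (r - b) * H' x"
    using MVT2[OF \<open>b < r\<close>, of H H'] H_deriv by blast
  have "H' x < 0" using decreasing below x b r by auto
  then have "(r - b) * H' x < 0" using \<open>b < r\<close> by (simp add: mult_less_0_iff)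
  then show False using x(3) r neg by simp
qed

section \<open>The smallest atom and the mass outside the largest one\<close>

text \<open>
  Divided by \<open>1 - w\<^sup>2\<close>, this is the inequality between the arithmetic and the geometric mean of the
  powers \<open>w\<^sup>2, w ^ 4, ..., w ^ (2 * n)\<close>. In the induction step the surplus is
  \<open>w\<^sup>2 * (1 - w) * (1 - w ^ n) * (1 - w ^ Suc n)\<close>.
\<close>

lemma geometric_mean_bound:
  fixes w :: real
  assumes "0 \<le> w" "w \<le> 1"
  shows "real n * (1 - w\<^sup>2) * w ^ Suc n \<le> w\<^sup>2 - w ^ (2 * Suc n)"
proof (induction n)
  case (Suc n)
  have "0 \<le> w\<^sup>2 * (1 - w) * ((1 - w ^ n) * (1 - w ^ Suc n))"
    using assms by (intro mult_nonneg_nonneg) (auto simp: power_le_one simp del: power_Suc)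
  also have "\<dots> = w\<^sup>2 * (1 - w) - w ^ Suc (Suc n) * (1 - w\<^sup>2) + (1 - w) * w ^ (2 * Suc n) * w"
    by (simp add: algebra_simps power2_eq_square power_mult_distrib flip: power_add mult_2)
  finally have "0 \<le> w\<^sup>2 * (1 - w) - w ^ Suc (Suc n) * (1 - w\<^sup>2) + (1 - w) * w ^ (2 * Suc n) * w" .
  moreover have "w * (real n * (1 - w\<^sup>2) * w ^ Suc n) \<le> w * (w\<^sup>2 - w ^ (2 * Suc n))"
    using Suc assms by (intro mult_left_mono) auto
  ultimately show ?case by (simp add: algebra_simps power2_eq_square)
qed simp

lemma one_minus_power_le:
  fixes w :: real
  assumes "0 \<le> w" "w \<le> 1" "k \<ge> 2"
  shows "1 - w ^ k \<le> real k * (1 - w\<^sup>2) / 2"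
  using \<open>k \<ge> 2\<close>
proof (induction k rule: dec_induct)
  case (step k)
  have "w ^ k \<le> w ^ 1" using step assms by (intro power_decreasing) auto
  then have "(1 - w) * w ^ k \<le> (1 - w) * ((1 + w) / 2)"
    using assms by (intro mult_left_mono) auto
  then show ?case using step by (simp add: algebra_simps power2_eq_square)
qed simp

lemma power_066_less:
  assumes "n \<ge> 4"
  shows "real (Suc n) * (66 / 100) ^ n < 1"
  using assms
proof (induction n rule: dec_induct)
  case (step n)
  have "real (Suc (Suc n)) * (66 / 100) ^ Suc n \<le> real (Suc n) * (66 / 100) ^ n"
    using step by (simp add: field_simps)
  then show ?case using step by linarith
qed (simp add: power_def)

text \<open>
  With \<open>t = q ^ 3\<close> the right-hand side is \<open>4 * t * (1 - t) * (1 + q\<^sup>2)\<close>. The first factor is concave in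
  \<open>t\<close>, hence controlled by its values at the ends, and the second one is increasing; splitting at
  \<open>7 / 10\<close> makes the two crude bounds sufficient.
\<close>

lemma middle_range_polynomial:
  fixes q :: real
  assumes "39 / 100 \<le> q\<^sup>2" "0 \<le> q" "q ^ 8 \<le> 1 / 2"
  shows "1 \<le> 4 * q\<^sup>2 * (1 + q\<^sup>2) * (q - q ^ 4)"
proof -
  have q1: "6244 / 10000 \<le> q"
    by (rule power2_le_imp_le) (use assms in \<open>auto simp: power2_eq_square\<close>)
  have q2: "q \<le> 9173 / 10000"
  proof (rule ccontr)
    assume "\<not> ?thesis"
    then have "(9173 / 10000) ^ 8 \<le> q ^ 8" by (intro power_mono) auto
    then show False using assms by (simp add: power_def)
  qed
  define t where "t = q ^ 3"
  have eq: "4 * q\<^sup>2 * (1 + q\<^sup>2) * (q - q ^ 4) = 4 * (t * (1 - t)) * (1 + q\<^sup>2)"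
    by (simp add: t_def eval_nat_numeral algebra_simps)
  show ?thesis
  proof (cases "q \<le> 7 / 10")
    case True
    have "(6244 / 10000) ^ 3 \<le> t" "t \<le> (7 / 10) ^ 3"
      unfolding t_def using True q1 assms by (auto intro: power_mono)
    then have t: "243 / 1000 \<le> t" "t \<le> 343 / 1000" by (auto simp: power_def)
    have "0 \<le> (t - 242 / 1000) * (758 / 1000 - t)" using t by (intro mult_nonneg_nonneg) auto
    then have "183 / 1000 \<le> t * (1 - t)" by (simp add: field_simps)
    then have "4 * (183 / 1000) * (139 / 100) \<le> 4 * (t * (1 - t)) * (1 + q\<^sup>2)"
      using assms by (intro mult_mono) auto
    then show ?thesis unfolding eq by simp
  next
    case False
    have "(7 / 10) ^ 3 \<le> t" "t \<le> (9173 / 10000) ^ 3"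
      unfolding t_def using False q2 assms by (auto intro: power_mono)
    then have t: "343 / 1000 \<le> t" "t \<le> 772 / 1000" by (auto simp: power_def)
    have "0 \<le> (t - 228 / 1000) * (772 / 1000 - t)" using t by (intro mult_nonneg_nonneg) auto
    then have "176 / 1000 \<le> t * (1 - t)" by (simp add: field_simps)
    moreover have "(7 / 10)\<^sup>2 \<le> q\<^sup>2" using False by (intro power_mono) auto
    ultimately have "4 * (176 / 1000) * (149 / 100) \<le> 4 * (t * (1 - t)) * (1 + q\<^sup>2)"
      using assms by (intro mult_mono) (auto simp: power2_eq_square)
    then show ?thesis unfolding eq by simp
  qed
qed

text \<open>
  Suppose that \<open>y = sqrt (1 - s) ^ Suc n\<close> is below \<open>s\<close>. Then the Bernoulli-type bound
  \<open>1 - k * s / 2 \<le> y\<close> forces \<open>s > 2 / (k + 2)\<close>, and the hypothesis on the mass makes the convex quadratic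
  \<open>(k - 2) * s\<^sup>2 - k * s + 1\<close> nonnegative. But this quadratic is negative at both \<open>2 / (k + 2)\<close> and
  \<open>1 / 2\<close>.
\<close>

lemma sqrt_power_ge_second_atom:
  assumes n: "n \<ge> 3" and s: "0 \<le> s" "s \<le> 1 / 2"
    and pw: "real n - real (Suc n) * (1 - s) \<le> (real n - 1) * (1 - s) ^ Suc n"
  shows "s \<le> sqrt (1 - s) ^ Suc n"
proof (rule ccontr)
  define k where "k = real (Suc n)"
  have k: "real n = k - 1" "k \<ge> 4" using n by (auto simp: k_def)
  define y where "y = sqrt (1 - s) ^ Suc n"
  have y: "0 \<le> y" "y\<^sup>2 = (1 - s) ^ Suc n"
    using s by (auto simp: y_def power2_eq_square simp flip: power_mult_distrib simp del: power_Suc)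
  assume "\<not> ?thesis"
  then have "y < s" by (simp add: y_def)
  have "1 - y \<le> k * (1 - (sqrt (1 - s))\<^sup>2) / 2"
    unfolding y_def k_def using s n by (intro one_minus_power_le) auto
  then have "1 - k * s / 2 < s" using s \<open>y < s\<close> by simp
  then have s': "2 < (k + 2) * s" by (simp add: algebra_simps)
  have "y\<^sup>2 \<le> s\<^sup>2" using \<open>y < s\<close> y by (intro power_mono) auto
  then have "(k - 2) * y\<^sup>2 \<le> (k - 2) * s\<^sup>2" using k by (intro mult_left_mono) auto
  moreover have "(k - 1) - k * (1 - s) \<le> (k - 2) * y\<^sup>2"
    using pw[folded k_def y(2)] unfolding k by simp
  ultimately have "0 \<le> (k - 2) * s\<^sup>2 - k * s + 1" by (simp add: algebra_simps)
  then have "0 \<le> (k + 2)\<^sup>2 * ((k - 2) * s\<^sup>2 - k * s + 1)" using k by simp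
  also have "\<dots> = (k + 2) * (k - 2) * (((k + 2) * s - 2) * (s - 1 / 2))
      + (4 * (k + 2) - (k\<^sup>2 + 12) / 2 * ((k + 2) * s))"
    by (simp add: field_simps power2_eq_square)
  also have "\<dots> < 0 + (4 * (k + 2) - (k\<^sup>2 + 12) / 2 * 2)"
  proof (rule add_le_less_mono)
    show "(k + 2) * (k - 2) * (((k + 2) * s - 2) * (s - 1 / 2)) \<le> 0"
      using s s' k by (intro mult_nonneg_nonpos[of "(k + 2) * (k - 2)"] mult_nonneg_nonpos) auto
    have "(k\<^sup>2 + 12) / 2 * 2 < (k\<^sup>2 + 12) / 2 * ((k + 2) * s)"
      using s' zero_le_power2[of k] by (intro mult_strict_left_mono) (auto intro: add_nonneg_pos)
    then show "4 * (k + 2) - (k\<^sup>2 + 12) / 2 * ((k + 2) * s) < 4 * (k + 2) - (k\<^sup>2 + 12) / 2 * 2"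
      by linarith
  qed
  also have "\<dots> = - (k - 2)\<^sup>2" by (simp add: power2_eq_square algebra_simps)
  also have "\<dots> \<le> 0" by simp
  finally show False by simp
qed

text \<open>
  Here \<open>n * m + X\<close> is the mass of a law outside its largest atom. Put \<open>u = 1 - s\<close>, \<open>L = n * m\<close>,
  \<open>c = n * s\<close>, \<open>x = sqrt X\<close> and \<open>y = sqrt (u ^ Suc n)\<close>; the claim is \<open>c * (x - x\<^sup>2) \<le> L * (L + x\<^sup>2)\<close>. The
  constraints give \<open>x \<le> y\<close>, \<open>u - y\<^sup>2 \<le> L\<close> and, from the geometric mean, \<open>c * y \<le> L\<close>.

  If \<open>y\<close> is close to 1, the second atom is small, and \<open>x\<close> is at most \<open>c / sqrt 2\<close> because the excess \<open>X\<close>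
  is second order in \<open>s\<close>. Otherwise \<open>c\<close> is eliminated by \<open>c * y \<le> L\<close>, and a quadratic in \<open>x\<close>
  remains to be shown nonnegative. For middle values of \<open>y\<close> its discriminant is not positive; for
  small \<open>y\<close> it decreases on \<open>[0, y]\<close> and its value at \<open>y\<close> is at least \<open>y * (y - s)\<close>.
\<close>

lemma min_atom_beats_geometric_loss:
  assumes n: "n \<ge> 3"
    and s: "0 \<le> s" "2 * s + (real n - 1) * m \<le> 1" "psi (Suc n) s \<le> m" "0 \<le> m"
    and X: "0 \<le> X" "X \<le> (real n - 1) * (s - m)" "s + real n * m + X \<le> 1"
  shows "s * (sqrt X - X) \<le> m * (real n * m + X)"
proof -
  define N where "N = real n"
  define u where "u = 1 - s"
  define y where "y = sqrt u ^ Suc n"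
  define L where "L = N * m"
  define c where "c = N * s"
  define x where "x = sqrt X"
  have N: "N \<ge> 3" using n by (simp add: N_def)
  have s_half: "s \<le> 1 / 2" using s N mult_nonneg_nonneg[of "N - 1" m] unfolding N_def by linarith
  have u: "1 / 2 \<le> u" "u \<le> 1" using s s_half by (auto simp: u_def)
  have crit: "1 \<le> real (Suc n) * u ^ n"
    unfolding u_def by (rule second_atom_bound[OF n s(1) s_half s(2,3)])
  have y: "0 < y" "y \<le> 1" using u by (auto simp: y_def power_le_one simp del: power_Suc)
  have y2: "y\<^sup>2 = u ^ Suc n"
    using u by (auto simp: y_def power2_eq_square simp flip: power_mult_distrib simp del: power_Suc)
  have L: "u - y\<^sup>2 \<le> L" "0 \<le> L"
    using psi_le_iff[of n s m] s n N unfolding y2 by (auto simp: L_def N_def u_def)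
  have cy: "c * y \<le> L"
  proof -
    have "real n * (1 - (sqrt u)\<^sup>2) * sqrt u ^ Suc n \<le> (sqrt u)\<^sup>2 - sqrt u ^ (2 * Suc n)"
      using u by (intro geometric_mean_bound) auto
    also have "\<dots> = u - y\<^sup>2" using u unfolding y_def power_even_eq by simp
    finally show ?thesis using L u by (simp add: c_def N_def u_def y_def)
  qed
  have x: "0 \<le> x" "x\<^sup>2 = X" using X by (auto simp: x_def)
  have "x \<le> y"
    by (rule power2_le_imp_le) (use X L y x in \<open>auto simp: L_def N_def u_def\<close>)
  have c0: "0 \<le> c" using s N by (simp add: c_def)
  have "c * (x - x\<^sup>2) \<le> L * (L + x\<^sup>2)"
  proof (cases "1 / 2 \<le> y ^ 4")
    case True
    have "N * (N * X) \<le> N * (N * ((N - 1) * (s - m)))"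
      using X N by (intro mult_left_mono) (auto simp: N_def)
    also have "\<dots> = N * (N - 1) * (N * (s - m))" by (simp add: algebra_simps)
    also have "\<dots> \<le> N * (N - 1) * (N * defect n s)"
      using s N by (intro mult_left_mono) (auto simp: defect_def)
    also have "\<dots> \<le> N * (N - 1) * (N * (N + 1) / 2 * s\<^sup>2)"
      using defect_upper[of n s] n s s_half N by (intro mult_left_mono) (auto simp: N_def algebra_simps)
    also have "\<dots> = (N * N * s\<^sup>2) / 2 * ((N - 1) * (N + 1))" by (simp add: field_simps)
    also have "\<dots> \<le> (N * N * s\<^sup>2) / 2 * (N * N)"
      using N by (intro mult_left_mono) (auto simp: algebra_simps)
    also have "\<dots> = N * (N * (c\<^sup>2 / 2))" by (simp add: c_def power2_eq_square)
    finally have "x\<^sup>2 \<le> c\<^sup>2 * (1 / 2)" using N x by simp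
    also have "\<dots> \<le> c\<^sup>2 * y ^ 4" using True by (intro mult_left_mono) auto
    also have "\<dots> = (c * y\<^sup>2)\<^sup>2" by (simp add: power_mult_distrib flip: power_mult)
    finally have "x \<le> c * y\<^sup>2" by (rule power2_le_imp_le) (use c0 in auto)
    then have "c * x \<le> c * (c * y\<^sup>2)" using c0 by (intro mult_left_mono) auto
    also have "\<dots> = (c * y) * (c * y)" by (simp add: power2_eq_square)
    also have "\<dots> \<le> L * L" using cy c0 y L by (intro mult_mono) auto
    finally show ?thesis using L c0 x
      by (simp add: algebra_simps) (smt (verit) mult_nonneg_nonneg zero_le_power2)
  next
    case False
    \<comment> \<open>The threshold \<open>366 / 1000\<close> is just under the root of \<open>2 * y * (1 + y) = 1\<close>; below it, the vertex
      \<open>1 / (2 * (1 + y))\<close> of the quadratic lies to the right of \<open>y\<close>.\<close>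
    have quad: "x \<le> y * L + (1 + y) * x\<^sup>2"
    proof (cases "366 / 1000 \<le> y")
      case True
      have disc: "1 \<le> 4 * y * (1 + y) * L"
      proof (cases "39 / 100 \<le> y")
        case True
        define q where "q = sqrt y"
        have q: "0 \<le> q" "q\<^sup>2 = y" using y by (auto simp: q_def)
        have "q ^ 8 = (q\<^sup>2) ^ 4" by (simp flip: power_mult)
        then have "1 \<le> 4 * q\<^sup>2 * (1 + q\<^sup>2) * (q - q ^ 4)"
          using q True False by (intro middle_range_polynomial) auto
        moreover have "q ^ 4 = y\<^sup>2" by (simp add: q(2)[symmetric] flip: power_mult)
        moreover have "q \<le> u"
        proof (rule power2_le_imp_le)
          have "sqrt u ^ Suc n \<le> sqrt u ^ 4"
            using u n by (intro power_decreasing) auto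
          also have "\<dots> = ((sqrt u)\<^sup>2)\<^sup>2" by (simp flip: power_mult)
          finally show "q\<^sup>2 \<le> u\<^sup>2" using q u by (simp add: y_def)
        qed (use u in auto)
        ultimately have "1 \<le> 4 * y * (1 + y) * (q - y\<^sup>2)" using q by simp
        also have "\<dots> \<le> 4 * y * (1 + y) * L"
          using y L \<open>q \<le> u\<close> by (intro mult_left_mono) auto
        finally show ?thesis .
      next
        case y39: False
        \<comment> \<open>For \<open>n = 3\<close> this range of \<open>y\<close> does not occur, since then \<open>y = u\<^sup>2\<close> and \<open>4 * u ^ 3 \<ge> 1\<close>.\<close>
        have "66 / 100 < u"
        proof (rule ccontr)
          assume u66: "\<not> ?thesis"
          show False
          proof (cases "n = 3")
            case True
            have "y = ((sqrt u)\<^sup>2)\<^sup>2" by (simp add: y_def True flip: power_mult)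
            then have "y = u\<^sup>2" using u by simp
            have "u < 6246 / 10000"
            proof (rule ccontr)
              assume "\<not> ?thesis"
              then have "(6246 / 10000)\<^sup>2 \<le> u\<^sup>2" by (intro power_mono) auto
              then show False using y39 \<open>y = u\<^sup>2\<close> by (simp add: power2_eq_square)
            qed
            then have "u ^ 3 \<le> (6246 / 10000) ^ 3" using u by (intro power_mono) auto
            then show False using crit True by (simp add: power_def)
          next
            case False
            have "real (Suc n) * u ^ n \<le> real (Suc n) * (66 / 100) ^ n"
              using u66 u by (intro mult_left_mono power_mono) auto
            then show False using power_066_less[of n] crit n False by linarith
          qed
        qed
        moreover have "y\<^sup>2 \<le> (39 / 100)\<^sup>2" using y39 y by (intro power_mono) auto
        ultimately have "507 / 1000 \<le> L" using L by (simp add: power2_eq_square)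
        then have "4 * (366 / 1000) * (1 + 366 / 1000) * (507 / 1000) \<le> 4 * y * (1 + y) * L"
          using True y by (intro mult_mono) auto
        then show ?thesis by simp
      qed
      have "0 \<le> (2 * (1 + y) * x - 1)\<^sup>2 + (4 * y * (1 + y) * L - 1)"
        using disc by (intro add_nonneg_nonneg) auto
      also have "\<dots> = 4 * (1 + y) * (y * L + (1 + y) * x\<^sup>2 - x)"
        by (simp add: power2_eq_square algebra_simps)
      finally show ?thesis using y by (simp add: zero_le_mult_iff)
    next
      case False
      have "s \<le> y"
        unfolding y_def u_def
        by (rule sqrt_power_ge_second_atom[OF n s(1) s_half second_atom_power[OF n s(1-3)]])
      have "(1 + y) * (x + y) \<le> 1366 / 1000 * (732 / 1000)"
        using False \<open>x \<le> y\<close> x y by (intro mult_mono) auto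
      then have "0 \<le> (y - x) * (1 - (1 + y) * (x + y))"
        using \<open>x \<le> y\<close> by (intro mult_nonneg_nonneg) auto
      moreover have "0 \<le> y * (L - (1 - y - y\<^sup>2))"
        using \<open>s \<le> y\<close> L y by (intro mult_nonneg_nonneg) (auto simp: u_def)
      ultimately show ?thesis by (simp add: algebra_simps power2_eq_square)
    qed
    have "x\<^sup>2 \<le> x" using power_decreasing[of 1 2 x] x(1) y \<open>x \<le> y\<close> by simp
    have "y * (c * (x - x\<^sup>2)) = (c * y) * (x - x\<^sup>2)" by simp
    also have "\<dots> \<le> L * (x - x\<^sup>2)"
      using cy \<open>x\<^sup>2 \<le> x\<close> by (intro mult_right_mono) auto
    also have "\<dots> \<le> L * (y * (L + x\<^sup>2))"
      using quad L by (intro mult_left_mono) (auto simp: algebra_simps)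
    finally have "y * (c * (x - x\<^sup>2)) \<le> y * (L * (L + x\<^sup>2))" by (simp add: mult_ac)
    then show ?thesis using y by simp
  qed
  then have "N * (s * (x - X)) \<le> N * (m * (L + X))"
    by (simp add: x c_def L_def mult_ac)
  then show ?thesis using N by (simp add: L_def N_def x_def)
qed

section \<open>Products with a law whose largest atom is at zero\<close>

text \<open>
  Let a law have its largest atom at zero, second atom \<open>s\<close>, smallest atom \<open>m\<close> and mass \<open>c\<close> on the
  units, and let another law have floor \<open>m'\<close> and total excess \<open>Y\<close> over this floor on the units. The
  floor averages the first law over the units, the excess mixes translates of it; so at the units the
  product has atoms between \<open>m * Y + m' * c\<close> and \<open>s * Y + m' * c\<close>. With \<open>q = m' * c\<close> the left-hand side is the
  condition of the body for these two bounds, and in terms of the defect \<open>q\<close> enters it only once.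
\<close>

lemma psi_mixture_iff:
  "psi (Suc n) (s * Y + q) \<le> m * Y + q \<longleftrightarrow> (s - m) * Y \<le> defect n (s * Y + q)"
  by (auto simp: defect_def algebra_simps)

text \<open>
  Comparison with the flow: the parameter \<open>b\<close> with \<open>b ^ Suc n = Y\<close> satisfies \<open>b \<le> 1 - z'\<close> because
  \<open>psi z' \<le> m'\<close>, so \<open>m'\<close> is at least the floor of the flow law with the same excess. Raising \<open>m'\<close> or \<open>c\<close>
  shifts floor and second atom by the same amount, which helps since the defect is increasing.
\<close>

lemma psi_le_of_one_max_at_zero:
  assumes n: "n \<ge> 3"
    and s: "0 \<le> s" "s \<le> 1" "1 \<le> real (Suc n) * (1 - s) ^ n" "psi (Suc n) s \<le> m"
    and c: "s + (real n - 1) * m \<le> c" "c \<le> real n * s"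
    and z': "0 \<le> z'" "psi (Suc n) z' \<le> m'" "0 \<le> m'"
    and Y: "Y = 1 - z' - real n * m'" "0 \<le> Y"
  shows "psi (Suc n) (s * Y + m' * c) \<le> m * Y + m' * c"
proof -
  have "m' * c \<le> m' * (real n * s)" using c z' by (intro mult_left_mono) auto
  then have "s * Y + m' * c \<le> s * (1 - z')" by (simp add: Y algebra_simps)
  also have "\<dots> \<le> s * 1" using s z' by (intro mult_left_mono) auto
  finally have t1: "s * Y + m' * c \<le> 1" using s by simp
  have psi0: "0 \<le> psi (Suc n) s" using psi_nonneg s by simp
  have c_low: "s + (real n - 1) * psi (Suc n) s \<le> c"
  proof -
    have "(real n - 1) * psi (Suc n) s \<le> (real n - 1) * m" using s n by (intro mult_left_mono) auto
    then show ?thesis using c by linarith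
  qed
  then have "0 \<le> c" using mult_nonneg_nonneg[of "real n - 1" "psi (Suc n) s"] psi0 s n by linarith
  have "0 \<le> real n * m'" using z' by simp
  then have Y1: "Y \<le> 1" using Y z' by linarith
  show ?thesis
  proof (cases "Y = 0")
    case True
    then show ?thesis
      unfolding psi_mixture_iff using defect_nonneg[of n "m' * c"] t1 n z' \<open>0 \<le> c\<close> by simp
  next
    case False
    define b where "b = root (Suc n) Y"
    have b: "0 < b" "b \<le> 1" "b ^ Suc n = Y"
      using False Y Y1 by (auto simp: b_def simp del: power_Suc)
    have "Y \<le> (1 - z') ^ Suc n"
      using psi_le_iff[of n z' m'] z' n Y by linarith
    moreover have "0 \<le> 1 - z'" using Y z' \<open>0 \<le> real n * m'\<close> by linarith
    ultimately have "b \<le> 1 - z'"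
      using b by (metis power_le_imp_le_base)
    then have "(b - Y) / real n \<le> m'" using Y n by (simp add: field_simps)
    then have "(b - Y) / real n * (s + (real n - 1) * psi (Suc n) s) \<le> m' * c"
      using c_low psi0 s n z' by (intro mult_mono) (auto intro: add_nonneg_nonneg)
    then have le: "b ^ Suc n * s + (b - b ^ Suc n) / real n * (s + (real n - 1) * psi (Suc n) s)
        \<le> s * Y + m' * c"
      unfolding b by simp
    have "(s - m) * Y \<le> b ^ Suc n * defect n s"
      unfolding b using s Y mult_right_mono[of "s - m" "defect n s" Y] by (simp add: defect_def mult.commute)
    also have "\<dots> \<le> defect n (b ^ Suc n * s + (b - b ^ Suc n) / real n * (s + (real n - 1) * psi (Suc n) s))"
      by (rule defect_flow[OF n s(1-3) b(1,2)])
    also have "\<dots> \<le> defect n (s * Y + m' * c)"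
    proof (rule defect_mono[OF _ _ le t1])
      have "b ^ Suc n \<le> b ^ 1" using b by (intro power_decreasing) auto
      then show "0 \<le> b ^ Suc n * s + (b - b ^ Suc n) / real n * (s + (real n - 1) * psi (Suc n) s)"
        using psi0 s n b by (intro add_nonneg_nonneg mult_nonneg_nonneg divide_nonneg_nonneg) auto
    qed (use n in simp)
    finally show ?thesis unfolding psi_mixture_iff .
  qed
qed

text \<open>
  The shift \<open>q\<close> lifts \<open>s * Y\<close> to at least \<open>s * sqrt Y\<close>, and at that point the defect still has the
  factor \<open>Y\<close> of its value at \<open>s\<close>, by \<open>defect_scale\<close>.
\<close>

lemma psi_le_of_geometric_gain:
  assumes n: "n \<ge> 3"
    and s: "0 \<le> s" "s \<le> 1" "psi (Suc n) s \<le> m"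
    and Y: "0 \<le> Y" "Y \<le> 1" "s * (sqrt Y - Y) \<le> q" "s * Y + q \<le> 1"
  shows "psi (Suc n) (s * Y + q) \<le> m * Y + q"
proof -
  have "(s - m) * Y \<le> (sqrt Y)\<^sup>2 * defect n s"
  proof -
    have "(s - m) * Y \<le> defect n s * Y" using s Y by (intro mult_right_mono) (auto simp: defect_def)
    then show ?thesis using Y by (simp add: mult.commute)
  qed
  also have "\<dots> \<le> defect n (sqrt Y * s)"
    using n s Y by (intro defect_scale) auto
  also have "\<dots> \<le> defect n (s * Y + q)"
    using n s Y by (intro defect_mono) (auto simp: algebra_simps)
  finally show ?thesis unfolding psi_mixture_iff .
qed

text \<open>
  Either law may play the role of the one that is spread. If both resulting bounds failed, then
  the hypothesis of \<open>psi_le_of_geometric_gain\<close> would fail twice, giving \<open>m' * c < s * (sqrt Y - Y)\<close> and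
  \<open>m * c' < s' * (sqrt X - X)\<close>. In the product of these two inequalities the factors regroup into
  \<open>(m * c) * (m' * c') < (s * (sqrt X - X)) * (s' * (sqrt Y - Y))\<close>, which contradicts
  \<open>min_atom_beats_geometric_loss\<close> for the two laws.
\<close>

lemma psi_le_of_both_max_at_zero:
  assumes n: "n \<ge> 3"
    and s: "0 \<le> s" "psi (Suc n) s \<le> m" "0 \<le> m"
      "X = c - real n * m" "s \<le> 1 - c" "X \<le> (real n - 1) * (s - m)" "s - m \<le> X" "m \<le> s"
    and s': "0 \<le> s'" "psi (Suc n) s' \<le> m'" "0 \<le> m'"
      "Y = c' - real n * m'" "s' \<le> 1 - c'" "Y \<le> (real n - 1) * (s' - m')" "s' - m' \<le> Y" "m' \<le> s'"
  shows "psi (Suc n) (s * Y + m' * c) \<le> m * Y + m' * c \<or>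
         psi (Suc n) (s' * X + m * c') \<le> m' * X + m * c'"
proof (rule ccontr)
  assume neg: "\<not> ?thesis"
  have gain: "s * (sqrt X - X) \<le> m * c"
    using min_atom_beats_geometric_loss[of n s m X] n s by (auto simp: algebra_simps)
  have gain': "s' * (sqrt Y - Y) \<le> m' * c'"
    using min_atom_beats_geometric_loss[of n s' m' Y] n s' by (auto simp: algebra_simps)
  have nm: "0 \<le> real n * m" "0 \<le> real n * m'" using s s' by auto
  have bounds: "0 \<le> X" "X \<le> 1" "0 \<le> Y" "Y \<le> 1" "s \<le> 1" "s' \<le> 1"
      "0 \<le> c" "c \<le> 1" "0 \<le> c'" "c' \<le> 1"
    using s s' nm by linarith+
  have c: "c \<le> real n * s" "c' \<le> real n * s'"
    using s s' by (auto simp: algebra_simps)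
  have "m' * c \<le> m' * (real n * s)" "m * c' \<le> m * (real n * s')"
    using c s s' by (auto intro: mult_left_mono)
  then have "s * Y + m' * c \<le> s * c'" "s' * X + m * c' \<le> s' * c"
    unfolding s s' by (simp_all add: algebra_simps)
  moreover have "s * c' \<le> 1" "s' * c \<le> 1" using bounds s s' by (auto intro: mult_le_one)
  ultimately have t1: "s * Y + m' * c \<le> 1" "s' * X + m * c' \<le> 1" by auto
  have "m' * c < s * (sqrt Y - Y)"
    using psi_le_of_geometric_gain[OF n s(1) _ s(2) bounds(3,4) _ t1(1)] neg bounds by force
  moreover have "m * c' < s' * (sqrt X - X)"
    using psi_le_of_geometric_gain[OF n s'(1) _ s'(2) bounds(1,2) _ t1(2)] neg bounds by force
  ultimately have "(m' * c) * (m * c') < (s * (sqrt Y - Y)) * (s' * (sqrt X - X))"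
    by (rule mult_strict_mono') (use s s' bounds in auto)
  also have "\<dots> = (s * (sqrt X - X)) * (s' * (sqrt Y - Y))" by simp
  also have "\<dots> \<le> (m * c) * (m' * c')"
  proof (rule mult_mono[OF gain gain'])
    have "Y \<le> sqrt Y" using bounds by (intro real_le_rsqrt) (simp add: power2_eq_square mult_left_le)
    then show "0 \<le> s' * (sqrt Y - Y)" using s' by simp
  qed (use s bounds in auto)
  finally show False by (simp add: mult_ac)
qed

section \<open>Atoms of a law and of a product of laws\<close>

lemma desc_atom_enumeration:
  assumes "finite A"
  obtains xs where "set xs = A" "distinct xs" "length xs = card A"
    "\<And>j. 1 \<le> j \<Longrightarrow> j \<le> card A \<Longrightarrow> desc_atom A p j = pmf p (xs ! (j - 1))"
    "\<And>i j. i \<le> j \<Longrightarrow> j < card A \<Longrightarrow> pmf p (xs ! j) \<le> pmf p (xs ! i)"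
proof -
  obtain l where l: "set l = A" "distinct l" using finite_distinct_list[OF assms] by blast
  define ys where "ys = sort_key (pmf p) l"
  have ys: "set ys = A" "distinct ys" "length ys = card A"
    using l distinct_card[OF l(2)] by (auto simp: ys_def)
  have "image_mset (pmf p) (mset_set A) = mset (map (pmf p) ys)"
    using l by (simp add: ys_def mset_set_set flip: mset_set_set)
  then have "sorted_list_of_multiset (image_mset (pmf p) (mset_set A)) = sort (map (pmf p) ys)"
    by (simp only: sorted_list_of_multiset_mset)
  also have "\<dots> = map (pmf p) ys"
    by (rule sort_key_id_if_sorted) (simp add: ys_def)
  finally have eq: "rev (sorted_list_of_multiset (image_mset (pmf p) (mset_set A))) = map (pmf p) (rev ys)"
    by (simp add: rev_map)
  have "sorted_wrt (\<lambda>x y. y \<le> x) (map (pmf p) (rev ys))"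
    by (simp add: ys_def flip: rev_map) (simp add: sorted_wrt_rev)
  then have "pmf p (rev ys ! j) \<le> pmf p (rev ys ! i)" if "i \<le> j" "j < card A" for i j
    using that ys by (cases "i = j") (auto simp: sorted_wrt_iff_nth_less)
  then show ?thesis
    using that[of "rev ys"] ys unfolding desc_atom_def eq by simp
qed

lemma desc_atom_2:
  assumes "finite A" "2 \<le> card A"
  obtains a1 a2 where "a1 \<in> A" "a2 \<in> A" "a1 \<noteq> a2"
    "pmf p a2 = desc_atom A p 2" "desc_atom A p 2 \<le> pmf p a1"
    "\<And>a. a \<in> A \<Longrightarrow> a \<noteq> a1 \<Longrightarrow> pmf p a \<le> desc_atom A p 2"
proof -
  obtain xs where xs: "set xs = A" "distinct xs" "length xs = card A"
    "\<And>j. 1 \<le> j \<Longrightarrow> j \<le> card A \<Longrightarrow> desc_atom A p j = pmf p (xs ! (j - 1))"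
    "\<And>i j. i \<le> j \<Longrightarrow> j < card A \<Longrightarrow> pmf p (xs ! j) \<le> pmf p (xs ! i)"
    using desc_atom_enumeration[OF assms(1)] by metis
  have eq: "desc_atom A p 2 = pmf p (xs ! 1)" using xs(4)[of 2] assms by simp
  note order = xs(5)[of 0 1] xs(5)[of 1]
  have "pmf p a \<le> pmf p (xs ! 1)" if a: "a \<in> A" "a \<noteq> xs ! 0" for a
  proof -
    obtain i where "i < card A" "a = xs ! i" using a(1) xs(1,3) by (metis in_set_conv_nth)
    moreover have "i \<noteq> 0" using a(2) \<open>a = xs ! i\<close> by metis
    ultimately show ?thesis using order(2)[of i] by simp
  qed
  moreover have "xs ! 0 \<noteq> xs ! 1" using xs(2,3) assms by (simp add: nth_eq_iff_index_eq)
  moreover have "xs ! 0 \<in> A" "xs ! 1 \<in> A" using xs(1,3) assms nth_mem[of 0 xs] nth_mem[of 1 xs] by auto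
  ultimately show ?thesis
    using that[of "xs ! 0" "xs ! 1"] order(1) assms unfolding eq by auto
qed

lemma desc_atom_card:
  assumes "finite A" "1 \<le> card A"
  shows desc_atom_card_le: "a \<in> A \<Longrightarrow> desc_atom A p (card A) \<le> pmf p a"
    and desc_atom_card_attained: "\<exists>a\<in>A. pmf p a = desc_atom A p (card A)"
proof -
  obtain xs where xs: "set xs = A" "distinct xs" "length xs = card A"
    "\<And>j. 1 \<le> j \<Longrightarrow> j \<le> card A \<Longrightarrow> desc_atom A p j = pmf p (xs ! (j - 1))"
    "\<And>i j. i \<le> j \<Longrightarrow> j < card A \<Longrightarrow> pmf p (xs ! j) \<le> pmf p (xs ! i)"
    using desc_atom_enumeration[OF assms(1)] by metis
  have eq: "desc_atom A p (card A) = pmf p (xs ! (card A - 1))" using xs(4) assms by simp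
  show "desc_atom A p (card A) \<le> pmf p a" if a: "a \<in> A"
  proof -
    obtain i where "i < card A" "a = xs ! i" using a xs(1,3) by (metis in_set_conv_nth)
    then show ?thesis using xs(5)[of i "card A - 1"] unfolding eq by auto
  qed
  have "xs ! (card A - 1) \<in> A" using xs(1,3) assms nth_mem[of "card A - 1" xs] by auto
  then show "\<exists>a\<in>A. pmf p a = desc_atom A p (card A)" using eq by auto
qed

lemma desc_atom_2_le:
  assumes "finite A" "2 \<le> card A" "\<And>a. a \<in> A \<Longrightarrow> a \<noteq> e \<Longrightarrow> pmf p a \<le> v"
  shows "desc_atom A p 2 \<le> v"
proof -
  obtain a1 a2 where "a1 \<in> A" "a2 \<in> A" "a1 \<noteq> a2"
    "pmf p a2 = desc_atom A p 2" "desc_atom A p 2 \<le> pmf p a1"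
    using desc_atom_2[OF assms(1,2)] by metis
  then show ?thesis using assms(3)[of a1] assms(3)[of a2] by (cases "a1 = e") auto
qed

text \<open>
  A law in the body with its data unpacked: a largest atom at \<open>a\<close>, second atom \<open>s\<close> and smallest atom \<open>m\<close>.
  Several points may carry the largest atom; naming one of them is what allows the distinction
  whether the peak sits at zero.
\<close>

definition peak_at :: "nat \<Rightarrow> 'a set \<Rightarrow> 'a pmf \<Rightarrow> 'a \<Rightarrow> real \<Rightarrow> real \<Rightarrow> bool" where
  "peak_at n A p a s m \<longleftrightarrow>
     finite A \<and> card A = Suc n \<and> set_pmf p \<subseteq> A \<and> a \<in> A \<and>
     s \<le> pmf p a \<and> (\<forall>x\<in>A - {a}. pmf p x \<le> s) \<and> (\<exists>x\<in>A - {a}. pmf p x = s) \<and>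
     (\<forall>x\<in>A. m \<le> pmf p x) \<and> (\<exists>x\<in>A. pmf p x = m) \<and> psi (Suc n) s \<le> m"

lemma body_peak:
  assumes "n \<ge> 3" "p \<in> body (Suc n) A"
  obtains a s m where "peak_at n A p a s m"
proof -
  have A: "card A = Suc n" "finite A" "set_pmf p \<subseteq> A"
    and psi: "psi (Suc n) (desc_atom A p 2) \<le> desc_atom A p (Suc n)"
    using assms card.infinite[of A] by (auto simp: body_def)
  have card2: "2 \<le> card A" using A assms by simp
  have min: "desc_atom A p (Suc n) \<le> pmf p x" if "x \<in> A" for x
    using desc_atom_card_le[of A x p] A that by simp
  have attained: "\<exists>x\<in>A. pmf p x = desc_atom A p (Suc n)"
    using desc_atom_card_attained[of A p] A by simp
  obtain a1 a2 where "a1 \<in> A" "a2 \<in> A" "a1 \<noteq> a2"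
    "pmf p a2 = desc_atom A p 2" "desc_atom A p 2 \<le> pmf p a1"
    "\<And>a. a \<in> A \<Longrightarrow> a \<noteq> a1 \<Longrightarrow> pmf p a \<le> desc_atom A p 2"
    using desc_atom_2[OF A(2) card2, of p] by blast
  then have "peak_at n A p a1 (desc_atom A p 2) (desc_atom A p (Suc n))"
    using A psi min attained unfolding peak_at_def by auto
  then show ?thesis by (rule that)
qed

lemma bodyI:
  assumes "n \<ge> 3" "finite A" "card A = Suc n" "set_pmf p \<subseteq> A"
    and "\<And>x. x \<in> A \<Longrightarrow> q \<le> pmf p x" "psi (Suc n) (desc_atom A p 2) \<le> q"
  shows "p \<in> body (Suc n) A"
proof -
  obtain x where "x \<in> A" "pmf p x = desc_atom A p (Suc n)"
    using desc_atom_card_attained[of A p] assms by auto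
  then show ?thesis using assms by (force simp: body_def)
qed

lemma sum_ge_with_atom:
  fixes f :: "'a \<Rightarrow> real"
  assumes "finite H" "card H = n" "b \<in> H" "\<And>x. x \<in> H \<Longrightarrow> m \<le> f x"
  shows "f b + (real n - 1) * m \<le> sum f H"
proof -
  have "real (card (H - {b})) * m \<le> sum f (H - {b})"
    using assms by (intro sum_bounded_below) auto
  moreover have "real (card (H - {b})) = real n - 1"
    using assms card_gt_0_iff[of H] by (auto simp: of_nat_diff)
  ultimately show ?thesis using sum.remove[of H b f] assms by simp
qed

lemma sum_le_with_atom:
  fixes f :: "'a \<Rightarrow> real"
  assumes "finite H" "card H = n" "b \<in> H" "\<And>x. x \<in> H \<Longrightarrow> f x \<le> s"
  shows "sum f H \<le> f b + (real n - 1) * s"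
  using sum_ge_with_atom[of H n b "- s" "\<lambda>x. - f x"] assms by (simp add: sum_negf)

lemma peak_at_bounds:
  assumes n: "n \<ge> 3" and p: "peak_at n A p a s m"
  shows "0 \<le> m" "m \<le> s" "2 * s + (real n - 1) * m \<le> 1" "s + real n * m \<le> 1" "s \<le> 1 / 2"
    "1 \<le> real (Suc n) * (1 - s) ^ n" "sum (pmf p) A = 1" "real (Suc n) * m \<le> 1"
proof -
  have A: "finite A" "card A = Suc n" "a \<in> A" and min: "\<And>x. x \<in> A \<Longrightarrow> m \<le> pmf p x"
    and psi: "psi (Suc n) s \<le> m" and a: "s \<le> pmf p a"
    using p by (auto simp: peak_at_def)
  show m: "0 \<le> m" using p by (auto simp: peak_at_def)
  obtain b where b: "b \<in> A - {a}" "pmf p b = s" using p by (auto simp: peak_at_def)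
  then show ms: "m \<le> s" using min by auto
  show sum: "sum (pmf p) A = 1"
    using p by (intro sum_pmf_eq_1) (auto simp: peak_at_def)
  have "pmf p b + (real n - 1) * m \<le> sum (pmf p) (A - {a})"
    using b A min by (intro sum_ge_with_atom) auto
  then show two: "2 * s + (real n - 1) * m \<le> 1"
    using a b sum sum.remove[of A a "pmf p"] A by simp
  then show one: "s + real n * m \<le> 1" using ms by (simp add: algebra_simps)
  then show "real (Suc n) * m \<le> 1" using ms by (simp add: algebra_simps)
  have "0 \<le> (real n - 1) * m" using n m by simp
  then show half: "s \<le> 1 / 2" using two by linarith
  show "1 \<le> real (Suc n) * (1 - s) ^ n"
    using second_atom_bound[OF n _ half two psi] m ms by simp
qed

text \<open>
  For the upper bound on \<open>c\<close>, some point other than \<open>z\<close> carries the smallest atom: if only \<open>z\<close> did,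
  the largest atom would equal the smallest one, and all atoms would agree.
\<close>

lemma peak_at_punctured:
  assumes n: "n \<ge> 3" and p: "peak_at n A p z s m"
    and c: "c = sum (pmf p) (A - {z})"
  shows "s \<le> 1 - c" "s + (real n - 1) * m \<le> c" "c \<le> m + (real n - 1) * s" "c \<le> real n * s"
proof -
  have A: "finite (A - {z})" "card (A - {z}) = n" "finite A" "z \<in> A"
    and min: "\<And>x. x \<in> A \<Longrightarrow> m \<le> pmf p x" and max: "\<And>x. x \<in> A - {z} \<Longrightarrow> pmf p x \<le> s"
    and z: "s \<le> pmf p z"
    using p by (auto simp: peak_at_def)
  note bounds = peak_at_bounds[OF n p]
  show "s \<le> 1 - c" using z bounds(7) sum.remove[of A z "pmf p"] A c by simp
  obtain b where b: "b \<in> A - {z}" "pmf p b = s" using p by (auto simp: peak_at_def)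
  show "s + (real n - 1) * m \<le> c"
    using sum_ge_with_atom[of "A - {z}" n b m "pmf p"] b A min c by simp
  obtain x where x: "x \<in> A" "pmf p x = m" using p by (auto simp: peak_at_def)
  have "\<exists>y\<in>A - {z}. pmf p y \<le> m"
  proof (cases "x = z")
    case True
    then have "s \<le> m" using x z by simp
    then show ?thesis using b by (intro bexI[of _ b]) auto
  qed (use x in auto)
  then obtain y where y: "y \<in> A - {z}" "pmf p y \<le> m" by auto
  show "c \<le> m + (real n - 1) * s"
    using sum_le_with_atom[of "A - {z}" n y "pmf p" s] y A max c by simp
  then show "c \<le> real n * s" using bounds(2) by (simp add: algebra_simps)
qed

lemma product_sum_lower:
  fixes f f' :: "'a \<Rightarrow> real"
  assumes "finite H" "bij_betw \<tau> H H" "\<And>x. x \<in> H \<Longrightarrow> m \<le> f x" "\<And>x. x \<in> H \<Longrightarrow> m' \<le> f' x"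
  shows "m * sum f' H + m' * sum f H - real (card H) * m * m' \<le> (\<Sum>h\<in>H. f h * f' (\<tau> h))"
proof -
  have "0 \<le> (\<Sum>h\<in>H. (f h - m) * (f' (\<tau> h) - m'))"
    using assms bij_betwE[OF assms(2)] by (intro sum_nonneg mult_nonneg_nonneg) auto
  also have "\<dots> = (\<Sum>h\<in>H. f h * f' (\<tau> h)) - m' * sum f H - m * (\<Sum>h\<in>H. f' (\<tau> h)) + real (card H) * m * m'"
    by (simp add: algebra_simps sum.distrib sum_subtractf sum_distrib_left)
  also have "(\<Sum>h\<in>H. f' (\<tau> h)) = sum f' H"
    using assms(2) by (rule sum.reindex_bij_betw)
  finally show ?thesis by simp
qed

lemma product_sum_upper_mixture:
  fixes f f' :: "'a \<Rightarrow> real"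
  assumes "finite H" "bij_betw \<tau> H H" "\<And>x. x \<in> H \<Longrightarrow> f x \<le> s" "\<And>x. x \<in> H \<Longrightarrow> m' \<le> f' x"
  shows "(\<Sum>h\<in>H. f h * f' (\<tau> h)) \<le> s * (sum f' H - real (card H) * m') + m' * sum f H"
  using product_sum_lower[of H \<tau> "- s" "\<lambda>h. - f h" m' f'] assms
  by (simp add: sum_negf algebra_simps)

text \<open>
  The summand at \<open>h0\<close> is the only one in which the second factor may be the large atom, and there
  the first factor is at most \<open>s\<close>.
\<close>

lemma product_sum_upper_off_peak:
  fixes f f' :: "'a \<Rightarrow> real"
  assumes H: "finite H" "bij_betw \<tau> H H" and h0: "h0 \<in> H" "f h0 \<le> s"
    and f: "\<And>x. x \<in> H \<Longrightarrow> 0 \<le> f x" "sum f H \<le> 1"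
    and f': "f' (\<tau> h0) \<le> 1" "\<And>x. x \<in> H \<Longrightarrow> x \<noteq> \<tau> h0 \<Longrightarrow> f' x \<le> s'" "0 \<le> s'" "s' \<le> 1"
  shows "(\<Sum>h\<in>H. f h * f' (\<tau> h)) \<le> s + s' - s * s'"
proof -
  have "(\<Sum>h\<in>H - {h0}. f h * f' (\<tau> h)) \<le> (\<Sum>h\<in>H - {h0}. f h * s')"
  proof (intro sum_mono mult_left_mono)
    fix h assume h: "h \<in> H - {h0}"
    then have "\<tau> h \<noteq> \<tau> h0" using H h0 by (auto simp: bij_betw_def inj_on_def)
    then show "f' (\<tau> h) \<le> s'" using f' h bij_betwE[OF H(2)] by auto
  qed (use f in auto)
  also have "\<dots> = (sum f H - f h0) * s'"
    using sum.remove[of H h0 f] H h0 by (simp add: sum_distrib_right)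
  also have "\<dots> \<le> (1 - f h0) * s'" using f f' by (intro mult_right_mono) auto
  finally have "(\<Sum>h\<in>H. f h * f' (\<tau> h)) \<le> f h0 * f' (\<tau> h0) + (1 - f h0) * s'"
    using sum.remove[of H h0 "\<lambda>h. f h * f' (\<tau> h)"] H h0 by simp
  also have "\<dots> \<le> f h0 * 1 + (1 - f h0) * s'" using f f' h0 by (intro add_right_mono mult_left_mono) auto
  also have "\<dots> = f h0 * (1 - s') + s'" by (simp add: algebra_simps)
  also have "\<dots> \<le> s * (1 - s') + s'" using h0 f' by (intro add_right_mono mult_right_mono) auto
  finally show ?thesis by (simp add: algebra_simps)
qed

lemma pmf_convolution_reindex:
  assumes "finite (carrier G)" "set_pmf \<mu> \<subseteq> carrier G" "set_pmf \<nu> \<subseteq> carrier G"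
    and "{(h, h') \<in> carrier G \<times> carrier G. h \<otimes>\<^bsub>G\<^esub> h' = g} = (\<lambda>h. (h, \<tau> h)) ` H"
  shows "pmf (convolution G \<mu> \<nu>) g = (\<Sum>h\<in>H. pmf \<mu> h * pmf \<nu> (\<tau> h))"
  unfolding pmf_convolution[OF assms(1-3)] assms(4)
  by (subst sum.reindex) (auto simp: inj_on_def)

text \<open>
  Away from the product \<open>a \<otimes> b\<close> of the peaks every atom is at most \<open>s + s' - s * s'\<close>, and every atom is at
  least \<open>q = m + m' - k * m * m'\<close> with \<open>k = n + 1\<close>. This \<open>q\<close> is the bound of \<open>psi_le_product_bound\<close> at \<open>z = m\<close>
  and \<open>z' = 0\<close>.
\<close>

lemma (in group) convolution_in_body:
  assumes n: "n \<ge> 3" and \<mu>: "\<mu> \<in> body (Suc n) (carrier G)" and \<nu>: "\<nu> \<in> body (Suc n) (carrier G)"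
  shows "convolution G \<mu> \<nu> \<in> body (Suc n) (carrier G)"
proof -
  let ?C = "carrier G" and ?L = "convolution G \<mu> \<nu>"
  obtain a s m where \<mu>p: "peak_at n ?C \<mu> a s m" using body_peak[OF n \<mu>] .
  obtain b s' m' where \<nu>p: "peak_at n ?C \<nu> b s' m'" using body_peak[OF n \<nu>] .
  note \<mu>b = peak_at_bounds[OF n \<mu>p] and \<nu>b = peak_at_bounds[OF n \<nu>p]
  have fin: "finite ?C" "card ?C = Suc n" and supp: "set_pmf \<mu> \<subseteq> ?C" "set_pmf \<nu> \<subseteq> ?C"
    and ab: "a \<in> ?C" "b \<in> ?C"
    and psi: "psi (Suc n) s \<le> m" "psi (Suc n) s' \<le> m'"
    and min: "\<And>x. x \<in> ?C \<Longrightarrow> m \<le> pmf \<mu> x" "\<And>x. x \<in> ?C \<Longrightarrow> m' \<le> pmf \<nu> x"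
    and max: "\<And>x. x \<in> ?C \<Longrightarrow> x \<noteq> a \<Longrightarrow> pmf \<mu> x \<le> s" "\<And>x. x \<in> ?C \<Longrightarrow> x \<noteq> b \<Longrightarrow> pmf \<nu> x \<le> s'"
    using \<mu>p \<nu>p by (auto simp: peak_at_def)
  have card2: "2 \<le> card ?C" using fin n by simp
  have suppL: "set_pmf ?L \<subseteq> ?C" using supp by (auto simp: convolution_def)
  define \<tau> where "\<tau> = (\<lambda>g h. inv h \<otimes> g)"
  have bij: "bij_betw (\<tau> g) ?C ?C" if "g \<in> ?C" for g
  proof (rule bij_betw_byWitness[where f' = "\<lambda>x. g \<otimes> inv x"])
    show "\<forall>h\<in>?C. g \<otimes> inv (\<tau> g h) = h"
      using that by (auto simp: \<tau>_def inv_mult_group m_assoc[symmetric])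
    show "\<forall>x\<in>?C. \<tau> g (g \<otimes> inv x) = x"
      using that by (auto simp: \<tau>_def inv_mult_group m_assoc)
  qed (use that in \<open>auto simp: \<tau>_def\<close>)
  have pmfL: "pmf ?L g = (\<Sum>h\<in>?C. pmf \<mu> h * pmf \<nu> (\<tau> g h))" if "g \<in> ?C" for g
  proof (rule pmf_convolution_reindex[OF fin(1) supp])
    show "{(h, h') \<in> ?C \<times> ?C. h \<otimes> h' = g} = (\<lambda>h. (h, \<tau> g h)) ` ?C"
      using that by (auto simp: \<tau>_def m_assoc[symmetric] image_iff)
  qed
  define q where "q = m + m' - real (Suc n) * m * m'"
  have low: "q \<le> pmf ?L g" if "g \<in> ?C" for g
    using product_sum_lower[OF fin(1) bij[OF that], of m "pmf \<mu>" m' "pmf \<nu>"] min \<mu>b(7) \<nu>b(7) fin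
    unfolding pmfL[OF that] q_def by simp
  define v where "v = desc_atom ?C ?L 2"
  have "v \<le> s + s' - s * s'"
    unfolding v_def
  proof (rule desc_atom_2_le[of _ "a \<otimes> b"])
    fix g assume g: "g \<in> ?C" "g \<noteq> a \<otimes> b"
    define h0 where "h0 = g \<otimes> inv b"
    have h0: "h0 \<in> ?C" "\<tau> g h0 = b"
      using g ab by (auto simp: h0_def \<tau>_def inv_mult_group m_assoc)
    have "h0 \<noteq> a" using g ab by (auto simp: h0_def m_assoc)
    then show "pmf ?L g \<le> s + s' - s * s'"
      unfolding pmfL[OF g(1)] using h0 max \<mu>b \<nu>b
      by (intro product_sum_upper_off_peak[OF fin(1) bij[OF g(1)] h0(1)]) (auto simp: pmf_le_1)
  qed (use fin n in auto)
  moreover have "m \<le> v"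
  proof -
    obtain a2 where "a2 \<in> ?C" "pmf ?L a2 = v"
      using desc_atom_2[OF fin(1) card2, of ?L] unfolding v_def by blast
    then have "q \<le> v" using low by auto
    moreover have "real (Suc n) * m * m' \<le> 1 * m'" using \<mu>b(8) \<nu>b(1) by (intro mult_right_mono) auto
    ultimately show ?thesis unfolding q_def by linarith
  qed
  ultimately have "psi (Suc n) v \<le> m * (1 - 0) + m' * (1 - m) - real n * m * m'"
    using \<mu>b \<nu>b psi n by (intro psi_le_product_bound[where s = s and s' = s']) auto
  then have "psi (Suc n) v \<le> q" by (simp add: q_def algebra_simps)
  then show ?thesis
    using bodyI[OF n fin suppL low] unfolding v_def by simp
qed

section \<open>Convolution on a finite field\<close>

lemma (in field) convolution_commute:
  assumes "set_pmf \<mu> \<subseteq> carrier R" "set_pmf \<nu> \<subseteq> carrier R"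
  shows "convolution R \<mu> \<nu> = convolution R \<nu> \<mu>"
proof -
  have "convolution R \<mu> \<nu> = map_pmf (\<lambda>(h, h'). h' \<otimes> h) (pair_pmf \<nu> \<mu>)"
    unfolding convolution_def by (subst pair_commute_pmf) (simp add: pmf.map_comp o_def case_prod_unfold)
  also have "\<dots> = convolution R \<nu> \<mu>"
    unfolding convolution_def using assms by (intro map_pmf_cong) (auto intro!: m_comm)
  finally show ?thesis .
qed

lemma (in field) unit_division_bij:
  assumes "finite (carrier R)" "g \<in> carrier R - {\<zero>}"
  shows "bij_betw (\<lambda>h. inv h \<otimes> g) (carrier R - {\<zero>}) (carrier R - {\<zero>})"
    and "{(h, h') \<in> carrier R \<times> carrier R. h \<otimes> h' = g} = (\<lambda>h. (h, inv h \<otimes> g)) ` (carrier R - {\<zero>})"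
proof -
  let ?H = "carrier R - {\<zero>}"
  have closed: "inv h \<in> carrier R" "h \<otimes> (inv h \<otimes> g) = g" if "h \<in> ?H" for h
  proof -
    have h: "h \<in> Units R" using that field_Units by simp
    then show "inv h \<in> carrier R" by simp
    then show "h \<otimes> (inv h \<otimes> g) = g" using h assms that by (simp add: m_assoc[symmetric])
  qed
  have maps: "inv h \<otimes> g \<in> ?H" if "h \<in> ?H" for h
    using closed[OF that] assms that by auto
  have "inj_on (\<lambda>h. inv h \<otimes> g) ?H"
  proof (rule inj_onI)
    fix h h' assume h: "h \<in> ?H" "h' \<in> ?H" "inv h \<otimes> g = inv h' \<otimes> g"
    then have "h \<otimes> (inv h \<otimes> g) = h' \<otimes> (inv h \<otimes> g)" using closed by metis
    then show "h = h'" using h maps[OF h(1)] by (simp add: m_rcancel)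
  qed
  moreover have "(\<lambda>h. inv h \<otimes> g) ` ?H = ?H"
    using assms maps calculation by (intro endo_inj_surj) auto
  ultimately show "bij_betw (\<lambda>h. inv h \<otimes> g) ?H ?H" by (simp add: bij_betw_def)
  show "{(h, h') \<in> carrier R \<times> carrier R. h \<otimes> h' = g} = (\<lambda>h. (h, inv h \<otimes> g)) ` ?H"
  proof (intro equalityI subsetI)
    fix x assume "x \<in> {(h, h') \<in> carrier R \<times> carrier R. h \<otimes> h' = g}"
    then obtain h h' where x: "x = (h, h')" "h \<in> carrier R" "h' \<in> carrier R" "h \<otimes> h' = g" by auto
    have h: "h \<in> ?H" using x assms by auto
    have "h \<otimes> (inv h \<otimes> g) = h \<otimes> h'" using closed[OF h] x by simp
    moreover have "inv h \<otimes> g \<in> carrier R" using maps[OF h] by simp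
    ultimately have "inv h \<otimes> g = h'" using m_lcancel[of h "inv h \<otimes> g" h'] h x(2,3) by blast
    then show "x \<in> (\<lambda>h. (h, inv h \<otimes> g)) ` ?H" using h x by auto
  qed (use closed maps in auto)
qed

lemma (in field) pmf_convolution_zero:
  assumes "finite (carrier R)" "set_pmf \<mu> \<subseteq> carrier R" "set_pmf \<nu> \<subseteq> carrier R"
  shows "pmf (convolution R \<mu> \<nu>) \<zero> = pmf \<mu> \<zero> + pmf \<nu> \<zero> - pmf \<mu> \<zero> * pmf \<nu> \<zero>"
proof -
  let ?C = "carrier R"
  have set: "{(h, h') \<in> ?C \<times> ?C. h \<otimes> h' = \<zero>} = {\<zero>} \<times> ?C \<union> (?C - {\<zero>}) \<times> {\<zero>}"
    using integral by auto
  have sum: "sum (pmf \<mu>) ?C = 1" "sum (pmf \<nu>) ?C = 1" using assms by (auto intro: sum_pmf_eq_1)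
  have "pmf (convolution R \<mu> \<nu>) \<zero> =
      (\<Sum>(h, h')\<in>{\<zero>} \<times> ?C. pmf \<mu> h * pmf \<nu> h') + (\<Sum>(h, h')\<in>(?C - {\<zero>}) \<times> {\<zero>}. pmf \<mu> h * pmf \<nu> h')"
    unfolding pmf_convolution[OF assms] set using assms by (intro sum.union_disjoint) auto
  also have "\<dots> = pmf \<mu> \<zero> * sum (pmf \<nu>) ?C + sum (pmf \<mu>) (?C - {\<zero>}) * pmf \<nu> \<zero>"
    by (simp add: sum.cartesian_product[symmetric] sum_distrib_left sum_distrib_right)
  also have "sum (pmf \<mu>) (?C - {\<zero>}) = 1 - pmf \<mu> \<zero>"
    using sum assms sum.remove[of ?C \<zero> "pmf \<mu>"] by simp
  finally show ?thesis using sum by (simp add: algebra_simps)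
qed

text \<open>
  The pair of laws is kept in a locale so that their roles can be exchanged by \<open>swap\<close>. The quantity
  \<open>low\<close> bounds all atoms of the product from below, and each case below only has to compare it with
  \<open>psi\<close> at the second atom.
\<close>

locale peaked_pair = field +
  fixes n \<mu> \<nu> a s m b s' m'
  assumes n: "n \<ge> 3"
    and \<mu>: "peak_at n (carrier R) \<mu> a s m"
    and \<nu>: "peak_at n (carrier R) \<nu> b s' m'"
begin

abbreviation "z \<equiv> pmf \<mu> \<zero>"
abbreviation "z' \<equiv> pmf \<nu> \<zero>"
abbreviation "H \<equiv> carrier R - {\<zero>}"
abbreviation "L \<equiv> convolution R \<mu> \<nu>"
abbreviation "low \<equiv> m * (1 - z') + m' * (1 - z) - real n * m * m'"

lemma swap: "peaked_pair R n \<nu> \<mu> b s' m' a s m"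
  using \<mu> \<nu> n by unfold_locales

lemmas \<mu>_bounds = peak_at_bounds[OF n \<mu>]
lemmas \<nu>_bounds = peak_at_bounds[OF n \<nu>]

lemma peak_facts:
  shows fin: "finite (carrier R)" "card (carrier R) = Suc n" "finite H" "card H = n"
    and supp: "set_pmf \<mu> \<subseteq> carrier R" "set_pmf \<nu> \<subseteq> carrier R"
    and peaks: "a \<in> carrier R" "b \<in> carrier R"
    and psi: "psi (Suc n) s \<le> m" "psi (Suc n) s' \<le> m'"
    and min: "\<And>x. x \<in> carrier R \<Longrightarrow> m \<le> pmf \<mu> x" "\<And>x. x \<in> carrier R \<Longrightarrow> m' \<le> pmf \<nu> x"
    and max: "\<And>x. x \<in> carrier R \<Longrightarrow> x \<noteq> a \<Longrightarrow> pmf \<mu> x \<le> s"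
      "\<And>x. x \<in> carrier R \<Longrightarrow> x \<noteq> b \<Longrightarrow> pmf \<nu> x \<le> s'"
  using \<mu> \<nu> by (auto simp: peak_at_def)

lemma supp_L: "set_pmf L \<subseteq> carrier R"
  using supp by (auto simp: convolution_def)

lemma sum_units: "sum (pmf \<mu>) H = 1 - z" "sum (pmf \<nu>) H = 1 - z'"
  using \<mu>_bounds(7) \<nu>_bounds(7) sum.remove[of "carrier R" \<zero> "pmf \<mu>"]
    sum.remove[of "carrier R" \<zero> "pmf \<nu>"] fin by auto

lemma pmf_L:
  assumes "g \<in> H"
  shows "pmf L g = (\<Sum>h\<in>H. pmf \<mu> h * pmf \<nu> (inv h \<otimes> g))"
  by (rule pmf_convolution_reindex[OF fin(1) supp unit_division_bij(2)[OF fin(1) assms]])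

lemma pmf_L_zero: "pmf L \<zero> = z + z' - z * z'"
  by (rule pmf_convolution_zero[OF fin(1) supp])

lemma low_le:
  assumes "g \<in> carrier R"
  shows "low \<le> pmf L g"
proof (cases "g = \<zero>")
  case True
  have "m * (1 - z') \<le> m * 1" using \<mu>_bounds(1) by (intro mult_left_mono) auto
  moreover have "m' * (1 - z) \<le> z' * (1 - z)"
    using min(2)[of \<zero>] by (intro mult_right_mono) (auto simp: pmf_le_1)
  moreover have "0 \<le> real n * m * m'" using \<mu>_bounds(1) \<nu>_bounds(1) by simp
  moreover have "m \<le> z" using min by simp
  ultimately have "low \<le> z + z' * (1 - z)" by linarith
  then show ?thesis using True by (simp add: pmf_L_zero algebra_simps)
next
  case False
  then have g: "g \<in> H" using assms by simp
  show ?thesis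
    using product_sum_lower[OF fin(3) unit_division_bij(1)[OF fin(1) g], of m "pmf \<mu>" m' "pmf \<nu>"] min
    unfolding pmf_L[OF g] sum_units fin(4) by simp
qed

lemma in_bodyI:
  assumes "psi (Suc n) (desc_atom (carrier R) L 2) \<le> low"
  shows "L \<in> body (Suc n) (carrier R)"
  using bodyI[OF n fin(1,2) supp_L low_le assms] .

lemma card2: "2 \<le> card (carrier R)" using fin n by simp

lemma second_atom_le_mixture:
  assumes "a = \<zero>"
  shows "desc_atom (carrier R) L 2 \<le> s * (1 - z' - real n * m') + m' * (1 - z)"
proof (rule desc_atom_2_le[OF fin(1) card2])
  fix g assume "g \<in> carrier R" "g \<noteq> \<zero>"
  then have g: "g \<in> H" by simp
  show "pmf L g \<le> s * (1 - z' - real n * m') + m' * (1 - z)"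
    using product_sum_upper_mixture[OF fin(3) unit_division_bij(1)[OF fin(1) g], of "pmf \<mu>" s m' "pmf \<nu>"]
      max min assms
    unfolding pmf_L[OF g] sum_units fin(4) by simp
qed

lemma in_body_of_mixture:
  assumes a: "a = \<zero>"
    and psi_le: "psi (Suc n) (s * (1 - z' - real n * m') + m' * (1 - z)) \<le> m * (1 - z' - real n * m') + m' * (1 - z)"
  shows "L \<in> body (Suc n) (carrier R)"
proof (rule in_bodyI)
  let ?v = "s * (1 - z' - real n * m') + m' * (1 - z)"
  have c: "1 - z \<le> real n * s"
    using peak_at_punctured(4)[OF n \<mu> refl] sum_units a by simp
  have "m' * (1 - z) \<le> m' * (real n * s)"
    using c \<nu>_bounds(1) by (intro mult_left_mono) auto
  then have "?v \<le> s * (1 - z')" by (simp add: algebra_simps)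
  also have "\<dots> \<le> s * 1" using \<mu>_bounds by (intro mult_left_mono) auto
  finally have "?v \<le> s" by simp
  have "psi (Suc n) (desc_atom (carrier R) L 2) \<le> psi (Suc n) ?v"
  proof (rule psi_mono[OF _ second_atom_le_mixture[OF a]])
    have "real (Suc n) * (1 - s) ^ n \<le> real (Suc n) * (1 - ?v) ^ n"
      using \<open>?v \<le> s\<close> \<mu>_bounds(5) by (intro mult_left_mono power_mono) auto
    then show "1 \<le> real (Suc n) * (1 - ?v) ^ n" using \<mu>_bounds(6) by linarith
    show "?v \<le> 1" using \<open>?v \<le> s\<close> \<mu>_bounds(5) by simp
  qed (use n in simp)
  also note psi_le
  also have "m * (1 - z' - real n * m') + m' * (1 - z) = low" by (simp add: algebra_simps)
  finally show "psi (Suc n) (desc_atom (carrier R) L 2) \<le> low" .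
qed

lemma in_body_one_peak_at_zero:
  assumes "a = \<zero>" "b \<noteq> \<zero>"
  shows "L \<in> body (Suc n) (carrier R)"
proof (rule in_body_of_mixture[OF assms(1)], rule psi_le_of_one_max_at_zero[OF n _ _ \<mu>_bounds(6) psi(1)])
  have z's': "z' \<le> s'" using max(2)[of \<zero>] assms by auto
  show "s + (real n - 1) * m \<le> 1 - z" "1 - z \<le> real n * s"
    using peak_at_punctured(2,4)[OF n \<mu> refl] sum_units assms by auto
  show "psi (Suc n) z' \<le> m'"
    using psi_mono[OF _ z's' _ \<nu>_bounds(6)] n \<nu>_bounds(5) psi(2) by simp
  show "0 \<le> 1 - z' - real n * m'" using \<nu>_bounds(4) z's' by simp
qed (use \<mu>_bounds \<nu>_bounds in auto)

lemma in_body_both_peaks_at_zero: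
  assumes "a = \<zero>" "b = \<zero>"
  shows "L \<in> body (Suc n) (carrier R)"
proof -
  interpret sw: peaked_pair R n \<nu> \<mu> b s' m' a s m by (rule swap)
  have \<mu>p: "s \<le> 1 - (1 - z)" "s + (real n - 1) * m \<le> 1 - z" "1 - z \<le> m + (real n - 1) * s"
    using peak_at_punctured[OF n \<mu> refl] sum_units assms by auto
  have \<nu>p: "s' \<le> 1 - (1 - z')" "s' + (real n - 1) * m' \<le> 1 - z'" "1 - z' \<le> m' + (real n - 1) * s'"
    using peak_at_punctured[OF n \<nu> refl] sum_units assms by auto
  have "psi (Suc n) (s * (1 - z' - real n * m') + m' * (1 - z)) \<le> m * (1 - z' - real n * m') + m' * (1 - z) \<or>
        psi (Suc n) (s' * (1 - z - real n * m) + m * (1 - z')) \<le> m' * (1 - z - real n * m) + m * (1 - z')"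
    using \<mu>_bounds(1,2) \<nu>_bounds(1,2) psi \<mu>p \<nu>p
    by (intro psi_le_of_both_max_at_zero[OF n]) (auto simp: algebra_simps)
  then show ?thesis
    using in_body_of_mixture[OF assms(1)] sw.in_body_of_mixture[OF assms(2)]
      convolution_commute[OF supp] by auto
qed

text \<open>
  As in a group, the second atom is at most \<open>s + s' - s * s'\<close>, the exceptional point being \<open>a \<otimes> b\<close>. If it
  is at least the atom \<open>z + z' - z * z'\<close> at zero, \<open>psi_le_product_bound\<close> applies to it. Otherwise the atom
  at zero is the largest one, \<open>psi_le_product_bound\<close> applies to that atom, and
  \<open>psi_second_of_psi_first\<close> passes to the second.
\<close>

lemma in_body_peaks_off_zero:
  assumes ab: "a \<noteq> \<zero>" "b \<noteq> \<zero>"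
  shows "L \<in> body (Suc n) (carrier R)"
proof (rule in_bodyI)
  let ?v = "desc_atom (carrier R) L 2"
  have z: "z \<le> s" "z' \<le> s'" using max ab by auto
  have core: "psi (Suc n) v \<le> low" if "z + z' - z * z' \<le> v" "v \<le> s + s' - s * s'" for v
    using z that \<mu>_bounds \<nu>_bounds psi n
    by (intro psi_le_product_bound[where s = s and s' = s']) auto
  have mono: "z + z' - z * z' \<le> s + s' - s * s'"
  proof -
    have "(1 - s) * (1 - s') \<le> (1 - z) * (1 - z')"
      using z \<mu>_bounds(5) \<nu>_bounds(5) by (intro mult_mono) auto
    then show ?thesis by (simp add: algebra_simps)
  qed
  have v_le: "?v \<le> s + s' - s * s'"
  proof (rule desc_atom_2_le[OF fin(1) card2, where e = "a \<otimes> b"])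
    fix g assume g: "g \<in> carrier R" "g \<noteq> a \<otimes> b"
    show "pmf L g \<le> s + s' - s * s'"
    proof (cases "g = \<zero>")
      case True
      then show ?thesis using mono by (simp add: pmf_L_zero)
    next
      case False
      then have gH: "g \<in> H" using g by simp
      note bij = unit_division_bij(1)[OF fin(1) gH]
      have "b \<in> (\<lambda>h. inv h \<otimes> g) ` H" using bij peaks ab by (auto simp: bij_betw_def)
      then obtain h0 where h0: "h0 \<in> H" "inv h0 \<otimes> g = b" by auto
      then have h0U: "h0 \<in> Units R" using field_Units by simp
      have "h0 \<otimes> (inv h0 \<otimes> g) = g"
        using h0U h0(1) g by (simp add: m_assoc[symmetric])
      then have "h0 \<otimes> b = g" unfolding h0(2) .
      then have "h0 \<noteq> a" using g by auto
      then show ?thesis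
        unfolding pmf_L[OF gH] using h0 max \<mu>_bounds \<nu>_bounds sum_units
        by (intro product_sum_upper_off_peak[OF fin(3) bij h0(1)]) (auto simp: pmf_le_1)
    qed
  qed
  show "psi (Suc n) ?v \<le> low"
  proof (cases "pmf L \<zero> \<le> ?v")
    case True
    then show ?thesis using core v_le by (simp add: pmf_L_zero)
  next
    case False
    obtain a1 a2 where a12: "a1 \<in> carrier R" "a2 \<in> carrier R" "a1 \<noteq> a2" "pmf L a2 = ?v"
      "\<And>a. a \<in> carrier R \<Longrightarrow> a \<noteq> a1 \<Longrightarrow> pmf L a \<le> ?v"
      by (rule desc_atom_2[OF fin(1) card2, of L], rule that) auto
    have "a1 = \<zero>" using a12(5)[of \<zero>] False by auto
    have "pmf L a2 + (real n - 1) * low \<le> sum (pmf L) H"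
      using a12 \<open>a1 = \<zero>\<close> fin low_le by (intro sum_ge_with_atom) auto
    also have "\<dots> = 1 - pmf L \<zero>"
      using sum_pmf_eq_1[OF fin(1) supp_L] sum.remove[of "carrier R" \<zero> "pmf L"] fin by simp
    finally have sum: "pmf L \<zero> + ?v + (real n - 1) * low \<le> 1" using a12(4) by simp
    have "psi (Suc n) (pmf L \<zero>) \<le> low" using core mono by (simp add: pmf_L_zero)
    moreover have "0 \<le> low"
    proof -
      have "psi (Suc n) (pmf L \<zero>) \<ge> 0" by (intro psi_nonneg) (auto simp: pmf_le_1)
      then show ?thesis using calculation by linarith
    qed
    moreover have "0 \<le> ?v" using a12(4)[symmetric] by simp
    ultimately show ?thesis
      using False sum by (intro psi_second_of_psi_first[OF n, of ?v "pmf L \<zero>" low]) auto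
  qed
qed

lemma convolution_in_body: "L \<in> body (Suc n) (carrier R)"
proof -
  interpret sw: peaked_pair R n \<nu> \<mu> b s' m' a s m by (rule swap)
  show ?thesis
    using in_body_one_peak_at_zero in_body_both_peaks_at_zero in_body_peaks_off_zero
      sw.in_body_one_peak_at_zero convolution_commute[OF supp] by metis
qed

end

theorem theorem1p1:
  fixes k :: nat
  assumes "k \<ge> 4"
  shows
    "(\<forall>(G :: ('a, 'b) monoid_scheme) \<mu> \<nu>.
        comm_group G \<and> order G = k \<and> \<mu> \<in> body k (carrier G) \<and> \<nu> \<in> body k (carrier G)
        \<longrightarrow> convolution G \<mu> \<nu> \<in> body k (carrier G)) \<and>
     (\<forall>(F :: ('c, 'd) ring_scheme) \<mu> \<nu>.
        field F \<and> order F = k \<and> \<mu> \<in> body k (carrier F) \<and> \<nu> \<in> body k (carrier F)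
        \<longrightarrow> convolution F \<mu> \<nu> \<in> body k (carrier F))"
proof -
  obtain n where k: "k = Suc n" and n: "n \<ge> 3" using assms by (cases k) auto
  show ?thesis
    unfolding k
  proof (intro conjI allI impI; elim conjE)
    fix G :: "('a, 'b) monoid_scheme" and \<mu> \<nu>
    assume G: "comm_group G" and body: "\<mu> \<in> body (Suc n) (carrier G)" "\<nu> \<in> body (Suc n) (carrier G)"
    show "convolution G \<mu> \<nu> \<in> body (Suc n) (carrier G)"
      by (rule group.convolution_in_body[OF comm_group.axioms(2)[OF G] n body])
  next
    fix F :: "('c, 'd) ring_scheme" and \<mu> \<nu>
    assume F: "field F" and body: "\<mu> \<in> body (Suc n) (carrier F)" "\<nu> \<in> body (Suc n) (carrier F)"
    obtain a s m where \<mu>: "peak_at n (carrier F) \<mu> a s m" using body_peak[OF n body(1)] .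
    obtain b s' m' where \<nu>: "peak_at n (carrier F) \<nu> b s' m'" using body_peak[OF n body(2)] .
    interpret field F by (rule F)
    interpret peaked_pair F n \<mu> \<nu> a s m b s' m' using n \<mu> \<nu> by unfold_locales
    show "convolution F \<mu> \<nu> \<in> body (Suc n) (carrier F)" by (rule convolution_in_body)
  qed
qed

end
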